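(* Let $X\subset\mathbb{P}^3$ be an irreducible reduced surface of degree $d\geq 3$ over $\mathbb{C}$. Assume $\Lambda$ is a line on $X$ such that $\Lambda\not\subset\mathrm{Sing}(X)$, and assume $\Lambda$ contains $d-1$ (distinct) $A_{d-1}$-singularities of $X$. Then a general point of $\Lambda$ is a star point of $X$.
   Context: The ground field is $\mathbb{C}$, and $\mathrm{Sing}(X)$ is the singular locus of $X$. A smooth point $P$ of an irreducible reduced surface $X\subset\mathbb{P}^3$ of degree $d\geq 3$ is called a star point on $X$ if the scheme $T_P(X)\cap X$ is a cone with vertex $P$, where $T_P(X)$ is the embedded tangent plane to $X$ at $P$; that is, in homogeneous coordinates $(Y_0:Y_1:Y_2)$ on $T_P(X)$ with $P=(1:0:0)$, the scheme $T_P(X)\cap X$ is defined by a form of degree $d$ not involving $Y_0$. A point $P$ of a surface $X\subset\mathbb{P}^3$ is an $A_k$-singularity ($k\geq 1$) if in suitable local analytic coordinates $(z_1,z_2,z_3)$ of $\mathbb{P}^3$ centered at $P$ the surface $X$ has equation $z_1^2+z_2^2+z_3^{k+1}=0$. "A general point of $\Lambda$" means every point of some nonempty Zariski open subset of $\Lambda$. *)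

theory Defs
  imports
    "HOL-Analysis.Analysis"
    "HOL-Library.Poly_Mapping"
    "HOL-Computational_Algebra.Factorial_Ring"
begin

type_synonym 'n cpoly = "('n \<Rightarrow>\<^sub>0 nat) \<Rightarrow>\<^sub>0 complex"

definition peval :: "'n::finite cpoly \<Rightarrow> complex ^ 'n \<Rightarrow> complex" where
  "peval F x = (\<Sum>m \<in> Poly_Mapping.keys F.
     Poly_Mapping.lookup F m * (\<Prod>i\<in>UNIV. x $ i ^ Poly_Mapping.lookup m i))"

text \<open>The zero polynomial is homogeneous of every degree.\<close>

definition homogeneous :: "nat \<Rightarrow> 'n::finite cpoly \<Rightarrow> bool" where
  "homogeneous d F \<longleftrightarrow>
     (\<forall>m \<in> Poly_Mapping.keys F. (\<Sum>i\<in>UNIV. Poly_Mapping.lookup m i) = d)"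

text \<open>In a term with exponent 0 at i the truncated subtraction of exponents is harmless,
  because its coefficient vanishes.\<close>

definition partial_deriv :: "'n \<Rightarrow> 'n::finite cpoly \<Rightarrow> 'n cpoly" where
  "partial_deriv i F = (\<Sum>m \<in> Poly_Mapping.keys F.
     Poly_Mapping.single (m - Poly_Mapping.single i 1)
       (of_nat (Poly_Mapping.lookup m i) * Poly_Mapping.lookup F m))"

text \<open>The polynomial F(A Y) in the variables Y, i.e. the pullback of F along the linear map
  with matrix A.\<close>

definition linear_subst :: "complex ^ 'm ^ 'n \<Rightarrow> 'n::finite cpoly \<Rightarrow> 'm::finite cpoly" where
  "linear_subst A F = (\<Sum>m \<in> Poly_Mapping.keys F.
     Poly_Mapping.single 0 (Poly_Mapping.lookup F m) *
     (\<Prod>i\<in>UNIV. (\<Sum>j\<in>UNIV. Poly_Mapping.single (Poly_Mapping.single j 1) (A $ i $ j))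
                  ^ Poly_Mapping.lookup m i))"

text \<open>Points of projective space are the one-dimensional linear subspaces, a line is the set of
  points contained in a two-dimensional linear subspace.\<close>

definition proj_space :: "(complex ^ 'n) set set" where
  "proj_space = {vec.span {x} | x. x \<noteq> 0}"

definition proj_line :: "(complex ^ 'n) set set \<Rightarrow> bool" where
  "proj_line \<Lambda> \<longleftrightarrow>
     (\<exists>L. vec.subspace L \<and> vec.dim L = 2 \<and> \<Lambda> = {p \<in> proj_space. p \<subseteq> L})"

definition zero_locus :: "'n::finite cpoly \<Rightarrow> (complex ^ 'n) set set" where
  "zero_locus F = {p \<in> proj_space. \<forall>x\<in>p. peval F x = 0}"

definition zariski_closed :: "(complex ^ 'n::finite) set set \<Rightarrow> bool" where
  "zariski_closed Z \<longleftrightarrow>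
     (\<exists>\<G>. (\<forall>G\<in>\<G>. \<exists>e. homogeneous e G) \<and> Z = proj_space \<inter> (\<Inter>G\<in>\<G>. zero_locus G))"

definition zariski_open_in ::
    "(complex ^ 'n::finite) set set \<Rightarrow> (complex ^ 'n) set set \<Rightarrow> bool" where
  "zariski_open_in Y V \<longleftrightarrow> (\<exists>Z. zariski_closed Z \<and> V = Y - Z)"

definition general_point ::
    "(complex ^ 'n::finite) set set \<Rightarrow> ((complex ^ 'n) set \<Rightarrow> bool) \<Rightarrow> bool" where
  "general_point Y Q \<longleftrightarrow> (\<exists>V. zariski_open_in Y V \<and> V \<noteq> {} \<and> (\<forall>p\<in>V. Q p))"

text \<open>The singular locus and the embedded tangent space of the hypersurface scheme F = 0
  (the tangent space is given as a linear subspace).\<close>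

definition sing_locus :: "'n::finite cpoly \<Rightarrow> (complex ^ 'n) set set" where
  "sing_locus F = {p \<in> zero_locus F. \<forall>i. \<forall>x\<in>p. peval (partial_deriv i F) x = 0}"

definition tangent_space ::
    "'n::finite cpoly \<Rightarrow> (complex ^ 'n) set \<Rightarrow> (complex ^ 'n) set" where
  "tangent_space F p = {y. \<forall>x\<in>p. (\<Sum>i\<in>UNIV. peval (partial_deriv i F) x * y $ i) = 0}"

text \<open>Homogeneous coordinates on the tangent plane at p are given by a matrix A that
  parametrizes it. The coordinates Y0, Y1, Y2 have indices 1, 2, 3 here, so p is
  the image of the first basis vector. In these coordinates the scheme cut out on the tangent
  plane by F is defined by the form F(A Y), and by no other form up to scalars.\<close>

definition star_point :: "nat \<Rightarrow> 4 cpoly \<Rightarrow> (complex ^ 4) set \<Rightarrow> bool" where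
  "star_point d F p \<longleftrightarrow>
     p \<in> zero_locus F \<and> p \<notin> sing_locus F \<and>
     (\<exists>A :: complex ^ 3 ^ 4.
        inj ((*v) A) \<and> range ((*v) A) = tangent_space F p \<and>
        vec.span {A *v axis 1 1} = p \<and>
        linear_subst A F \<noteq> 0 \<and> homogeneous d (linear_subst A F) \<and>
        (\<forall>m \<in> Poly_Mapping.keys (linear_subst A F). Poly_Mapping.lookup m 1 = 0))"

text \<open>Complex differentiability: the real Frechet derivative exists and is complex linear.\<close>

definition holomorphic_fun :: "(complex ^ 'n::finite \<Rightarrow> complex) \<Rightarrow> (complex ^ 'n) set \<Rightarrow> bool"
  where
  "holomorphic_fun f U \<longleftrightarrow>
     (\<forall>x\<in>U. \<exists>a :: complex ^ 'n. (f has_derivative (\<lambda>v. \<Sum>i\<in>UNIV. a $ i * v $ i)) (at x))"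

text \<open>A system of local analytic coordinates of projective 3-space centered at p, with its
  inverse: W is the cone over an open neighbourhood of p, the coordinate functions are the
  components of the scaling invariant map \<zeta>, and they identify the neighbourhood with the
  open set U. The inverse U -> P^3 is given by a lift \<phi> to homogeneous coordinates; such a
  lift always exists after shrinking the neighbourhood.\<close>

definition local_coordinates ::
    "(complex ^ 4) set \<Rightarrow> (complex ^ 4) set \<Rightarrow> (complex ^ 4 \<Rightarrow> complex ^ 3) \<Rightarrow>
     (complex ^ 3) set \<Rightarrow> (complex ^ 3 \<Rightarrow> complex ^ 4) \<Rightarrow> bool" where
  "local_coordinates p W \<zeta> U \<phi> \<longleftrightarrow>
     open W \<and> 0 \<notin> W \<and> open U \<and>
     (\<forall>x\<in>W. \<forall>c. c \<noteq> 0 \<longrightarrow> c *s x \<in> W \<and> \<zeta> (c *s x) = \<zeta> x) \<and>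
     (\<forall>i. holomorphic_fun (\<lambda>x. \<zeta> x $ i) W) \<and>
     (\<forall>i. holomorphic_fun (\<lambda>z. \<phi> z $ i) U) \<and>
     (\<forall>x\<in>W. \<zeta> x \<in> U \<and> \<phi> (\<zeta> x) \<in> vec.span {x}) \<and>
     (\<forall>z\<in>U. \<phi> z \<in> W \<and> \<zeta> (\<phi> z) = z) \<and>
     (\<forall>x\<in>p - {0}. x \<in> W \<and> \<zeta> x = 0)"

text \<open>That the surface has the equation g = 0 near p means that g generates its local ideal,
  i.e. that g agrees with the local equation F o \<phi> up to a holomorphic unit u.\<close>

definition A_singularity :: "nat \<Rightarrow> 4 cpoly \<Rightarrow> (complex ^ 4) set \<Rightarrow> bool" where
  "A_singularity k F p \<longleftrightarrow>
     k \<ge> 1 \<and> p \<in> zero_locus F \<and>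
     (\<exists>W \<zeta> U \<phi> u.
        local_coordinates p W \<zeta> U \<phi> \<and>
        holomorphic_fun u U \<and> (\<forall>z\<in>U. u z \<noteq> 0) \<and>
        (\<forall>z\<in>U. peval F (\<phi> z) = u z * ((z $ 1)\<^sup>2 + (z $ 2)\<^sup>2 + (z $ 3) ^ (k + 1))))"

text \<open>An irreducible reduced surface of degree d in projective 3-space is given by its equation,
  an irreducible form of degree d.\<close>

definition irreducible_surface :: "nat \<Rightarrow> 4 cpoly \<Rightarrow> bool" where
  "irreducible_surface d F \<longleftrightarrow> homogeneous d F \<and> irreducible F"

end

theory Submission
  imports Defs "HOL-Complex_Analysis.Cauchy_Integral_Formula"
begin

text \<open>
  On the line \<open>\<Lambda>\<close> the partial derivatives of \<open>F\<close> are forms of degree \<open>d - 1\<close> that vanish at the \<open>d - 1\<close>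
  singular points, so they are proportional to one form \<open>h\<close> with simple zeros, and the tangent plane
  is the same plane \<open>\<Pi>\<close> at all smooth points of \<open>\<Lambda>\<close>. In coordinates with \<open>\<Lambda> = {y = z = 0}\<close> and
  \<open>\<Pi> = {z = 0}\<close> write \<open>F = y\<^sup>m A + z g\<close>, where \<open>A\<close> does not vanish identically on \<open>\<Lambda>\<close> and
  \<open>g = h\<close> on \<open>\<Lambda>\<close>. If \<open>m < d\<close>, then \<open>A\<close> has at most \<open>d - m < d - 1\<close> zeros on \<open>\<Lambda>\<close>, so \<open>A\<close> is nonzero at
  some singular point, which would then be of type \<open>A\<^bsub>m-1\<^esub>\<close>. This contradicts the smooth curve through an
  \<open>A\<^bsub>d-1\<^esub>\<close>-singularity along which the gradient of \<open>F\<close> vanishes to order \<open>d - 1\<close>. Hence \<open>m = d\<close> and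
  \<open>F\<close> restricts to a multiple of \<open>y\<^sup>d\<close> on \<open>\<Pi>\<close>, which is nonzero because \<open>F\<close> is irreducible.
\<close>

subsection \<open>Polynomials\<close>

text \<open>An \<open>A_k\<close>-singularity is given through unknown analytic coordinates, so
  \<open>k\<close> has to be compared with the form \<open>F\<close>. A one-sided comparison
  suffices. At a chosen singular point where \<open>A\<close> is nonzero, \<open>g\<close> has a
  simple zero along \<Lambda>, so \<open>y\<close>, \<open>z\<close>, \<open>g\<close> have
  independent differentials there. Along a curve through that point with nonzero
  \<open>y\<close>-velocity, \<open>y^m\<close> contributes order exactly \<open>m - 1\<close> to
  the gradient, which is too low if \<open>m < d\<close>. Once \<open>y\<close> has zero velocity,
  the other partial derivatives force the same for \<open>z\<close> and \<open>g\<close>, so the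
  curve would have velocity zero in P^3. The computation takes place in C^4, where zero velocity in
  P^3 means a velocity in the span of the point; this explains the condition
  \<open>v \<notin> vec.span {\<gamma> 0}\<close>. The zero count for \<open>A\<close> requires
  \<open>m \<ge> 2\<close>. This is where the plane \<open>z = 0\<close> being tangent along all of
  \<Lambda> enters: the derivative of \<open>F\<close> in direction \<open>y\<close> then vanishes
  on \<Lambda>.\<close>

lemma poly_mapping_sum_single:
  fixes F :: "'a \<Rightarrow>\<^sub>0 'b::comm_monoid_add"
  shows "F = (\<Sum>m\<in>Poly_Mapping.keys F. Poly_Mapping.single m (Poly_Mapping.lookup F m))"
proof (rule poly_mapping_eqI)
  fix k
  show "Poly_Mapping.lookup F k =
    Poly_Mapping.lookup (\<Sum>m\<in>Poly_Mapping.keys F. Poly_Mapping.single m (Poly_Mapping.lookup F m)) k"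
    by (cases "k \<in> Poly_Mapping.keys F")
       (auto simp: lookup_sum lookup_single when_def sum.delta in_keys_iff)
qed

lemma peval_superset:
  assumes "finite K" "Poly_Mapping.keys F \<subseteq> K"
  shows "peval F x = (\<Sum>m\<in>K. Poly_Mapping.lookup F m * (\<Prod>i\<in>UNIV. x $ i ^ Poly_Mapping.lookup m i))"
  unfolding peval_def
  by (rule sum.mono_neutral_left) (use assms in \<open>auto simp: in_keys_iff\<close>)

lemma peval_0 [simp]: "peval 0 x = 0"
  by (simp add: peval_def)

lemma peval_single [simp]:
  "peval (Poly_Mapping.single m c) x = c * (\<Prod>i\<in>UNIV. x $ i ^ Poly_Mapping.lookup m i)"
  by (subst peval_superset[of "{m}"]) auto

lemma peval_1 [simp]: "peval 1 x = 1"
  using peval_single[of 0 1 x] by (simp del: peval_single)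

lemma peval_add [simp]: "peval (F + G) x = peval F x + peval G x"
proof -
  let ?K = "Poly_Mapping.keys F \<union> Poly_Mapping.keys G"
  have "peval (F + G) x = (\<Sum>m\<in>?K. Poly_Mapping.lookup (F + G) m * (\<Prod>i\<in>UNIV. x $ i ^ Poly_Mapping.lookup m i))"
    by (rule peval_superset) (use keys_add[of F G] in auto)
  also have "\<dots> = peval F x + peval G x"
    by (subst (1 2) peval_superset[of ?K]) (auto simp: lookup_add ring_distribs sum.distrib)
  finally show ?thesis .
qed

lemma peval_sum [simp]: "peval (\<Sum>a\<in>A. f a) x = (\<Sum>a\<in>A. peval (f a) x)"
  by (induction A rule: infinite_finite_induct) auto

lemma peval_diff [simp]: "peval (F - G) x = peval F x - peval G x"
  using peval_add[of "F - G" G x] by (simp del: peval_add)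

lemma peval_mult [simp]: "peval (F * G) x = peval F x * peval G x"
proof -
  have 1: "peval (Poly_Mapping.single m c * Poly_Mapping.single n e) x =
      peval (Poly_Mapping.single m c) x * peval (Poly_Mapping.single n e) x" for m n c e
    by (simp add: mult_single lookup_add power_add prod.distrib)
  have "peval (F * G) x = peval ((\<Sum>m\<in>Poly_Mapping.keys F. Poly_Mapping.single m (Poly_Mapping.lookup F m)) *
        (\<Sum>m\<in>Poly_Mapping.keys G. Poly_Mapping.single m (Poly_Mapping.lookup G m))) x"
    using poly_mapping_sum_single[of F] poly_mapping_sum_single[of G] by simp
  also have "\<dots> = (\<Sum>m\<in>Poly_Mapping.keys F. peval (Poly_Mapping.single m (Poly_Mapping.lookup F m)) x) *
        (\<Sum>m\<in>Poly_Mapping.keys G. peval (Poly_Mapping.single m (Poly_Mapping.lookup G m)) x)"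
    unfolding sum_product peval_sum 1 ..
  also have "\<dots> = peval F x * peval G x"
    unfolding peval_sum[symmetric] poly_mapping_sum_single[symmetric] ..
  finally show ?thesis .
qed

lemma peval_prod [simp]: "peval (\<Prod>a\<in>A. f a) x = (\<Prod>a\<in>A. peval (f a) x)"
  by (induction A rule: infinite_finite_induct) auto

lemma peval_power [simp]: "peval (F ^ n) x = peval F x ^ n"
  by (induction n) auto

lemma prod_power_single [simp]:
  "(\<Prod>i\<in>UNIV. (x::complex^'n::finite) $ i ^ Poly_Mapping.lookup (Poly_Mapping.single j k) i) = x $ j ^ k"
proof -
  have "(\<Prod>i\<in>UNIV. x $ i ^ Poly_Mapping.lookup (Poly_Mapping.single j k) i) = (\<Prod>i\<in>UNIV. if i = j then x $ i ^ k else 1)"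
    by (rule prod.cong) (auto simp: lookup_single when_def)
  then show ?thesis by simp
qed

lemma peval_linear_subst [simp]: "peval (linear_subst A F) y = peval F (A *v y)"
proof -
  have "peval F (A *v y) = (\<Sum>m\<in>Poly_Mapping.keys F. Poly_Mapping.lookup F m *
      (\<Prod>i\<in>UNIV. (\<Sum>j\<in>UNIV. A $ i $ j * y $ j) ^ Poly_Mapping.lookup m i))"
    unfolding peval_def matrix_vector_mult_def by simp
  then show ?thesis by (simp add: linear_subst_def)
qed

text \<open>Induction on the variables: with the others fixed, grouping the terms by their exponent
  \<open>k\<close> of \<open>j\<close> gives a univariate polynomial in \<open>z\<close> that
  vanishes everywhere, so every group vanishes. The index set and \<open>e\<close> stay abstract
  because inside a group the terms are separated by their exponents in \<open>S\<close>
  alone.\<close>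

lemma sum_monomials_eq_0:
  fixes e :: "'m \<Rightarrow> 'n \<Rightarrow> nat" and c :: "'m \<Rightarrow> complex"
  assumes "finite S" "finite M" "\<And>m m'. \<lbrakk>m \<in> M; m' \<in> M; \<forall>i\<in>S. e m i = e m' i\<rbrakk> \<Longrightarrow> m = m'"
    and "\<And>x. (\<Sum>m\<in>M. c m * (\<Prod>i\<in>S. x i ^ e m i)) = 0" "m \<in> M"
  shows "c m = 0"
  using assms
proof (induction S arbitrary: M m rule: finite_induct)
  case empty
  then have "M = {m}" by auto
  then show ?case using empty.prems(3) by simp
next
  case (insert j S)
  define Mk where "Mk k = {m\<in>M. e m j = k}" for k
  define N where "N = Max ((\<lambda>m. e m j) ` M)"
  have N: "e m j \<le> N" if "m \<in> M" for m
    using that insert.prems(1) by (simp add: N_def)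
  have "(\<Sum>m\<in>Mk k. c m * (\<Prod>i\<in>S. x i ^ e m i)) = 0" for x k
  proof (cases "k \<le> N")
    case True
    have "(\<Sum>k\<le>N. (\<Sum>m\<in>Mk k. c m * (\<Prod>i\<in>S. x i ^ e m i)) * z ^ k) = 0" for z
    proof -
      have "0 = (\<Sum>m\<in>M. c m * (\<Prod>i\<in>insert j S. (x(j:=z)) i ^ e m i))"
        using insert.prems(3) by simp
      also have "\<dots> = (\<Sum>m\<in>M. c m * (\<Prod>i\<in>S. x i ^ e m i) * z ^ e m j)"
      proof (rule sum.cong[OF refl])
        fix m
        have "(\<Prod>i\<in>S. (x(j:=z)) i ^ e m i) = (\<Prod>i\<in>S. x i ^ e m i)"
          by (rule prod.cong) (use insert.hyps in auto)
        then show "c m * (\<Prod>i\<in>insert j S. (x(j:=z)) i ^ e m i) = c m * (\<Prod>i\<in>S. x i ^ e m i) * z ^ e m j"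
          using insert.hyps by simp
      qed
      also have "\<dots> = (\<Sum>k\<le>N. \<Sum>m\<in>Mk k. c m * (\<Prod>i\<in>S. x i ^ e m i) * z ^ e m j)"
        unfolding Mk_def
        by (rule sum.group[symmetric]) (use insert.prems(1) N in auto)
      also have "\<dots> = (\<Sum>k\<le>N. (\<Sum>m\<in>Mk k. c m * (\<Prod>i\<in>S. x i ^ e m i)) * z ^ k)"
        by (auto simp: sum_distrib_right Mk_def intro!: sum.cong)
      finally show ?thesis by simp
    qed
    then show ?thesis
      using polyfun_eq_0[of "\<lambda>k. \<Sum>m\<in>Mk k. c m * (\<Prod>i\<in>S. x i ^ e m i)" N] True by auto
  next
    case False
    then have "Mk k = {}" using N by (auto simp: Mk_def)
    then show ?thesis by simp
  qed
  moreover have "m \<in> Mk (e m j)" using insert.prems by (simp add: Mk_def)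
  moreover have "finite (Mk k)" for k using insert.prems(1) by (simp add: Mk_def)
  moreover have "m1 = m2" if "m1 \<in> Mk k" "m2 \<in> Mk k" "\<forall>i\<in>S. e m1 i = e m2 i" for m1 m2 k
    using that by (intro insert.prems(2)) (auto simp: Mk_def)
  ultimately show ?case
    using insert.IH[of "Mk (e m j)" m] by blast
qed

text \<open>This is what allows polynomial identities, in particular those for linear substitutions,
  to be checked pointwise.\<close>

lemma peval_eq_0_imp:
  assumes "\<And>x. peval F x = 0"
  shows "F = 0"
proof -
  have "Poly_Mapping.lookup F m = 0" if m: "m \<in> Poly_Mapping.keys F" for m
  proof (rule sum_monomials_eq_0[where m = m and S = UNIV and M = "Poly_Mapping.keys F" and e = Poly_Mapping.lookup])
    show "(\<Sum>m\<in>Poly_Mapping.keys F. Poly_Mapping.lookup F m * (\<Prod>i\<in>UNIV. x i ^ Poly_Mapping.lookup m i)) = 0" for x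
      using assms[of "\<chi> i. x i"] by (simp add: peval_def)
  qed (use m in \<open>auto intro: poly_mapping_eqI\<close>)
  then show ?thesis
    by (metis in_keys_iff keys_eq_empty ex_in_conv)
qed

lemma peval_inject:
  assumes "\<And>x. peval F x = peval G x"
  shows "F = G"
  using peval_eq_0_imp[of "F - G"] assms by simp

text \<open>Setting the variables in \<open>I\<close> to 0 leaves exactly the part \<open>Q\<close>
  of \<open>P\<close> that is free of them. All values of \<open>Q\<close> are therefore 0, so
  \<open>Q\<close> is the zero polynomial and no key of \<open>P\<close> avoids
  \<open>I\<close>.\<close>

lemma key_of_vanishing:
  assumes "\<And>x. \<lbrakk>\<And>i. i \<in> I \<Longrightarrow> x $ i = 0\<rbrakk> \<Longrightarrow> peval P x = 0" "k \<in> Poly_Mapping.keys P"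
  shows "\<exists>i\<in>I. Poly_Mapping.lookup k i \<noteq> 0"
proof (rule ccontr)
  assume neg: "\<not> ?thesis"
  define K where "K = {k \<in> Poly_Mapping.keys P. \<forall>i\<in>I. Poly_Mapping.lookup k i = 0}"
  define Q where "Q = (\<Sum>k\<in>K. Poly_Mapping.single k (Poly_Mapping.lookup P k))"
  have K: "finite K" "K \<subseteq> Poly_Mapping.keys P" "k \<in> K"
    using assms(2) neg by (auto simp: K_def)
  have "peval Q x = 0" for x
  proof -
    define x' where "x' = (\<chi> i. if i \<in> I then 0 else x $ i)"
    have "0 = peval P x'"
      by (rule assms(1)[symmetric]) (simp add: x'_def)
    also have "\<dots> = (\<Sum>m\<in>K. Poly_Mapping.lookup P m * (\<Prod>i\<in>UNIV. x' $ i ^ Poly_Mapping.lookup m i))"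
      unfolding peval_def
    proof (rule sum.mono_neutral_right)
      show "\<forall>m\<in>Poly_Mapping.keys P - K. Poly_Mapping.lookup P m * (\<Prod>i\<in>UNIV. x' $ i ^ Poly_Mapping.lookup m i) = 0"
      proof
        fix m assume "m \<in> Poly_Mapping.keys P - K"
        then obtain i where "i \<in> I" "Poly_Mapping.lookup m i \<noteq> 0" by (auto simp: K_def)
        then have "x' $ i ^ Poly_Mapping.lookup m i = 0" by (simp add: x'_def)
        then show "Poly_Mapping.lookup P m * (\<Prod>i\<in>UNIV. x' $ i ^ Poly_Mapping.lookup m i) = 0"
          by (metis UNIV_I finite mult_zero_right prod_zero)
      qed
    qed (use K in auto)
    also have "\<dots> = (\<Sum>m\<in>K. Poly_Mapping.lookup P m * (\<Prod>i\<in>UNIV. x $ i ^ Poly_Mapping.lookup m i))"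
      by (intro sum.cong refl arg_cong2[of _ _ _ _ "(*)"] prod.cong) (auto simp: x'_def K_def)
    also have "\<dots> = peval Q x" by (simp add: Q_def)
    finally show ?thesis by simp
  qed
  then have "Q = 0" by (rule peval_eq_0_imp)
  moreover have "Poly_Mapping.lookup Q k = Poly_Mapping.lookup P k"
    using K by (simp add: Q_def lookup_sum lookup_single when_def)
  ultimately show False using assms(2) by (simp add: in_keys_iff)
qed

section \<open>Homogeneous forms\<close>

lemma homogeneous_0: "homogeneous n 0"
  by (simp add: homogeneous_def)

lemma homogeneous_single:
  "(\<Sum>i\<in>UNIV. Poly_Mapping.lookup m i) = n \<Longrightarrow> homogeneous n (Poly_Mapping.single m c)"
  by (simp add: homogeneous_def)

lemma homogeneous_add: "homogeneous n F \<Longrightarrow> homogeneous n G \<Longrightarrow> homogeneous n (F + G)"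
  unfolding homogeneous_def using keys_add[of F G] by blast

lemma homogeneous_sum:
  "(\<And>a. a \<in> A \<Longrightarrow> homogeneous n (f a)) \<Longrightarrow> homogeneous n (\<Sum>a\<in>A. f a)"
  by (induction A rule: infinite_finite_induct) (auto simp: homogeneous_0 homogeneous_add)

lemma homogeneous_mult:
  assumes "homogeneous n F" "homogeneous k G"
  shows "homogeneous (n + k) (F * G)"
  unfolding homogeneous_def
proof
  fix m assume "m \<in> Poly_Mapping.keys (F * G)"
  then obtain a b where "m = a + b" "a \<in> Poly_Mapping.keys F" "b \<in> Poly_Mapping.keys G"
    using keys_mult[of F G] by blast
  then show "(\<Sum>i\<in>UNIV. Poly_Mapping.lookup m i) = n + k"
    using assms by (simp add: homogeneous_def lookup_add sum.distrib)
qed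

lemma homogeneous_1: "homogeneous 0 1"
  by (simp add: homogeneous_def)

lemma homogeneous_power: "homogeneous n F \<Longrightarrow> homogeneous (k * n) (F ^ k)"
  by (induction k) (auto simp: homogeneous_1 homogeneous_mult)

lemma homogeneous_prod:
  "(\<And>a. a \<in> A \<Longrightarrow> homogeneous (n a) (f a)) \<Longrightarrow> homogeneous (\<Sum>a\<in>A. n a) (\<Prod>a\<in>A. f a)"
  by (induction A rule: infinite_finite_induct) (auto simp: homogeneous_1 homogeneous_mult)

lemma sum_lookup_single [simp]:
  "(\<Sum>i\<in>(UNIV::'n::finite set). Poly_Mapping.lookup (Poly_Mapping.single j (n::nat)) i) = n"
  by (simp add: lookup_single when_def)

lemma homogeneous_linear_subst:
  assumes "homogeneous d F"
  shows "homogeneous d (linear_subst A F)"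
  unfolding linear_subst_def
proof (rule homogeneous_sum)
  fix m assume m: "m \<in> Poly_Mapping.keys F"
  have "homogeneous (0 + (\<Sum>i\<in>UNIV. Poly_Mapping.lookup m i * 1))
      (Poly_Mapping.single 0 (Poly_Mapping.lookup F m) *
       (\<Prod>i\<in>UNIV. (\<Sum>j\<in>UNIV. Poly_Mapping.single (Poly_Mapping.single j 1) (A $ i $ j)) ^ Poly_Mapping.lookup m i))"
    by (intro homogeneous_mult homogeneous_prod homogeneous_power homogeneous_sum homogeneous_single) auto
  then show "homogeneous d (Poly_Mapping.single 0 (Poly_Mapping.lookup F m) *
       (\<Prod>i\<in>UNIV. (\<Sum>j\<in>UNIV. Poly_Mapping.single (Poly_Mapping.single j 1) (A $ i $ j)) ^ Poly_Mapping.lookup m i))"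
    using assms m by (simp add: homogeneous_def)
qed

lemma sum_lookup_minus_single:
  fixes m :: "'n::finite \<Rightarrow>\<^sub>0 nat"
  assumes "k \<le> Poly_Mapping.lookup m i"
  shows "(\<Sum>j\<in>UNIV. Poly_Mapping.lookup (m - Poly_Mapping.single i k) j) + k = (\<Sum>j\<in>UNIV. Poly_Mapping.lookup m j)"
proof -
  have "(m - Poly_Mapping.single i k) + Poly_Mapping.single i k = m"
    by (rule poly_mapping_eqI) (use assms in \<open>auto simp: lookup_add lookup_minus lookup_single when_def\<close>)
  then have "(\<Sum>j\<in>UNIV. Poly_Mapping.lookup m j) =
      (\<Sum>j\<in>UNIV. Poly_Mapping.lookup (m - Poly_Mapping.single i k) j + Poly_Mapping.lookup (Poly_Mapping.single i k) j)"
    by (metis lookup_add)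
  then show ?thesis by (simp add: sum.distrib)
qed

lemma homogeneous_partial_deriv:
  assumes "homogeneous d F"
  shows "homogeneous (d - 1) (partial_deriv i F)"
  unfolding partial_deriv_def
proof (rule homogeneous_sum)
  fix m assume m: "m \<in> Poly_Mapping.keys F"
  show "homogeneous (d - 1) (Poly_Mapping.single (m - Poly_Mapping.single i 1)
         (of_nat (Poly_Mapping.lookup m i) * Poly_Mapping.lookup F m))"
  proof (cases "Poly_Mapping.lookup m i = 0")
    case False
    then show ?thesis
      using assms m sum_lookup_minus_single[of 1 m i]
      by (intro homogeneous_single) (auto simp: homogeneous_def)
  qed (simp add: homogeneous_0)
qed

lemma peval_scale:
  assumes "homogeneous d F"
  shows "peval F (c *s x) = c ^ d * peval F x"
proof -
  have "(\<Prod>i\<in>UNIV. (c *s x) $ i ^ Poly_Mapping.lookup m i) = c ^ d * (\<Prod>i\<in>UNIV. x $ i ^ Poly_Mapping.lookup m i)"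
    if "m \<in> Poly_Mapping.keys F" for m
    using assms that
    by (simp add: homogeneous_def power_mult_distrib prod.distrib flip: power_sum)
  then show ?thesis by (simp add: peval_def sum_distrib_left mult_ac)
qed

section \<open>Differentiation of polynomial functions\<close>

text \<open>Links formal and analytic derivatives, so that product and chain rules for polynomials
  follow from uniqueness of the derivative.\<close>

lemma has_derivative_peval:
  "(peval F has_derivative (\<lambda>v. \<Sum>i\<in>UNIV. peval (partial_deriv i F) x * v $ i)) (at x)"
proof -
  let ?l = Poly_Mapping.lookup
  \<comment> \<open>Holds also when \<open>m\<close> has exponent 0 at \<open>i\<close>, since the
    subtraction is truncated on both sides.\<close>
  have pm: "(\<Prod>j\<in>UNIV. x $ j ^ ?l (m - Poly_Mapping.single i 1) j) =
     x $ i ^ (?l m i - 1) * (\<Prod>j\<in>UNIV - {i}. x $ j ^ ?l m j)" for m i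
  proof -
    have "(\<Prod>j\<in>UNIV - {i}. x $ j ^ ?l (m - Poly_Mapping.single i 1) j) = (\<Prod>j\<in>UNIV - {i}. x $ j ^ ?l m j)"
      by (rule prod.cong) (auto simp: lookup_minus lookup_single)
    then show ?thesis
      by (subst prod.remove[of _ i]) (auto simp: lookup_minus)
  qed
  have coord: "((\<lambda>x. x $ i ^ n) has_derivative (\<lambda>v. of_nat n * (v $ i) * x $ i ^ (n - 1))) (at x)" for i n
    by (rule has_derivative_power) (rule bounded_linear_imp_has_derivative, rule bounded_linear_vec_nth)
  have "((\<lambda>x. \<Sum>m\<in>Poly_Mapping.keys F. ?l F m * (\<Prod>i\<in>UNIV. x $ i ^ ?l m i)) has_derivative
     (\<lambda>v. \<Sum>m\<in>Poly_Mapping.keys F. ?l F m * (\<Sum>i\<in>UNIV. of_nat (?l m i) * (v $ i) * x $ i ^ (?l m i - 1) * 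
        (\<Prod>j\<in>UNIV - {i}. x $ j ^ ?l m j)))) (at x)"
    by (intro has_derivative_sum has_derivative_mult_right has_derivative_prod coord)
  moreover have "(\<Sum>m\<in>Poly_Mapping.keys F. ?l F m * (\<Sum>i\<in>UNIV. of_nat (?l m i) * (v $ i) * x $ i ^ (?l m i - 1) * 
        (\<Prod>j\<in>UNIV - {i}. x $ j ^ ?l m j))) = (\<Sum>i\<in>UNIV. peval (partial_deriv i F) x * v $ i)" for v
    unfolding partial_deriv_def peval_sum peval_single pm
    by (simp add: sum_distrib_left sum_distrib_right mult_ac) (rule sum.swap)
  ultimately show ?thesis
    unfolding peval_def[abs_def] by simp
qed

lemma continuous_on_peval [continuous_intros]:
  assumes "continuous_on S f"
  shows "continuous_on S (\<lambda>x. peval F (f x))"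
  unfolding peval_def by (intro continuous_intros assms)

lemma continuous_on_peval_UNIV: "continuous_on UNIV (peval F)"
  using continuous_on_peval[OF continuous_on_id] by simp

lemma isCont_peval: "isCont (peval F) x"
  by (rule has_derivative_continuous[OF has_derivative_peval])

lemma tendsto_peval [tendsto_intros]:
  "(f \<longlongrightarrow> x) net \<Longrightarrow> ((\<lambda>t. peval F (f t)) \<longlongrightarrow> peval F x) net"
  by (rule isCont_tendsto_compose[OF isCont_peval])

lemma partial_deriv_linear_subst:
  "peval (partial_deriv j (linear_subst B F)) y = (\<Sum>i\<in>UNIV. B $ i $ j * peval (partial_deriv i F) (B *v y))"
proof -
  have "((\<lambda>y. peval F (B *v y)) has_derivative (\<lambda>v. \<Sum>i\<in>UNIV. peval (partial_deriv i F) (B *v y) * (B *v v) $ i)) (at y)"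
    by (rule has_derivative_compose[OF bounded_linear_imp_has_derivative has_derivative_peval])
       (rule matrix_vector_mul_bounded_linear)
  moreover have "((\<lambda>y. peval F (B *v y)) has_derivative (\<lambda>v. \<Sum>i\<in>UNIV. peval (partial_deriv i (linear_subst B F)) y * v $ i)) (at y)"
    using has_derivative_peval[of "linear_subst B F" y] unfolding peval_linear_subst[abs_def] .
  ultimately have "(\<lambda>v. \<Sum>i\<in>UNIV. peval (partial_deriv i F) (B *v y) * (B *v v) $ i) = 
     (\<lambda>v. \<Sum>i\<in>UNIV. peval (partial_deriv i (linear_subst B F)) y * v $ i)"
    by (rule has_derivative_unique)
  from fun_cong[OF this, of "axis j 1"] have
    "(\<Sum>i\<in>UNIV. peval (partial_deriv i F) (B *v y) * (B *v axis j 1) $ i) =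
     peval (partial_deriv j (linear_subst B F)) y"
    by (simp add: axis_def if_distrib cong: if_cong)
  moreover have "(B *v axis j 1) $ i = B $ i $ j" for i
    by (simp add: matrix_vector_mult_def axis_def if_distrib cong: if_cong)
  ultimately show ?thesis by (simp add: mult.commute)
qed

subsection \<open>Holomorphic functions of several variables\<close>

lemma norm_smult_vec: "norm (c *s v) = norm c * norm (v :: 'a::real_normed_field ^ 'n::finite)"
  by (simp add: norm_vec_def norm_mult L2_set_right_distrib)

lemma has_derivative_vecI:
  fixes f :: "'a::real_normed_vector \<Rightarrow> 'b::real_normed_vector ^ 'n::finite"
  assumes "\<And>i. ((\<lambda>x. f x $ i) has_derivative (\<lambda>h. f' h $ i)) F"
  shows "(f has_derivative f') F"
proof -
  have bl: "bounded_linear (axis i :: 'b \<Rightarrow> 'b ^ 'n)" for i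
    by (rule bounded_linear_intro[where K = 1]) (auto simp: vec_eq_iff axis_def norm_vec_def if_distrib[of norm] intro: order.trans[OF L2_set_le_sum] cong: if_cong)
  have "((\<lambda>x. \<Sum>i\<in>UNIV. axis i (f x $ i)) has_derivative (\<lambda>h. \<Sum>i\<in>UNIV. axis i (f' h $ i))) F"
    by (intro has_derivative_sum bounded_linear.has_derivative[OF bl] assms)
  moreover have "(\<Sum>i\<in>UNIV. axis i (v $ i)) = v" for v :: "'b ^ 'n"
    by (simp add: vec_eq_iff axis_def)
  ultimately show ?thesis by simp
qed

text \<open>Passes from several variables to one: a complex linear Frechet derivative composed with
  a complex curve is an ordinary complex derivative.\<close>

lemma DERIV_compose_vec:
  fixes c :: "complex \<Rightarrow> complex ^ 'n::finite"
  assumes "\<And>l. ((\<lambda>s. c s $ l) has_field_derivative k l) (at s)"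
    and "(f has_derivative (\<lambda>v. \<Sum>i\<in>UNIV. a $ i * v $ i)) (at (c s))"
  shows "((\<lambda>s. f (c s)) has_field_derivative (\<Sum>i\<in>UNIV. a $ i * k i)) (at s)"
proof -
  have "(c has_derivative (\<lambda>h. \<chi> l. k l * h)) (at s)"
    by (rule has_derivative_vecI) (use assms(1) in \<open>simp add: has_field_derivative_def\<close>)
  moreover have "(\<lambda>x. \<Sum>i\<in>UNIV. a $ i * (k i * x)) = (*) (\<Sum>i\<in>UNIV. a $ i * k i)"
    by (auto simp: sum_distrib_right mult.assoc)
  ultimately show ?thesis
    using has_derivative_compose[of c "\<lambda>h. \<chi> l. k l * h" s UNIV f, OF _ assms(2)] by (simp add: has_field_derivative_def)
qed

lemma DERIV_line:
  fixes x v :: "complex ^ 'n::finite"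
  assumes "(f has_derivative (\<lambda>v. \<Sum>i\<in>UNIV. a $ i * v $ i)) (at (x + s *s v))"
  shows "((\<lambda>s. f (x + s *s v)) has_field_derivative (\<Sum>i\<in>UNIV. a $ i * v $ i)) (at s)"
  by (rule DERIV_compose_vec[where c = "\<lambda>s. x + s *s v", OF _ assms]) (auto intro!: derivative_eq_intros)

lemma DERIV_peval_line:
  "((\<lambda>s. peval F (x + s *s axis i 1)) has_field_derivative peval (partial_deriv i F) x) (at 0)"
proof -
  have "(\<Sum>j\<in>UNIV. (\<chi> i. peval (partial_deriv i F) x) $ j * axis i 1 $ j) = peval (partial_deriv i F) x"
    by (simp add: axis_def if_distrib cong: if_cong)
  then show ?thesis
    using DERIV_line[of "peval F" "\<chi> i. peval (partial_deriv i F) x" x 0 "axis i 1"] has_derivative_peval[of F x]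
    by simp
qed

lemma holomorphic_fun_continuous:
  assumes "holomorphic_fun f U" "x \<in> U"
  shows "isCont f x"
  using assms has_derivative_continuous unfolding holomorphic_fun_def by blast

text \<open>\<open>holomorphic_fun\<close> asserts differentiability at each point but no continuity
  of the derivative. The bound comes from Cauchy's inequality on discs in the coordinate directions,
  where \<open>f\<close> is bounded by continuity. Quantifying over all coefficient vectors
  \<open>a\<close> covers any later choice of them.\<close>

lemma holomorphic_fun_locally_bounded:
  fixes f :: "complex ^ 'n::finite \<Rightarrow> complex"
  assumes f: "holomorphic_fun f U" and "open U" "x0 \<in> U"
  shows "\<exists>B. \<forall>\<^sub>F x in nhds x0. norm (f x) \<le> B \<and>
    (\<forall>a. (f has_derivative (\<lambda>v. \<Sum>i\<in>UNIV. a $ i * v $ i)) (at x) \<longrightarrow> (\<forall>i. norm (a $ i) \<le> B))"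
proof -
  define M where "M = norm (f x0) + 1"
  have "(f \<longlongrightarrow> f x0) (nhds x0)"
    using holomorphic_fun_continuous[OF f \<open>x0 \<in> U\<close>] by (simp add: continuous_at tendsto_nhds_iff)
  then have "\<forall>\<^sub>F x in nhds x0. dist (f x) (f x0) < 1"
    by (rule tendstoD) simp
  moreover have "\<forall>\<^sub>F x in nhds x0. x \<in> U"
    using assms(2,3) by (rule eventually_nhds_in_open)
  ultimately have "\<forall>\<^sub>F x in nhds x0. norm (f x) \<le> M \<and> x \<in> U"
  proof eventually_elim
    case (elim x)
    then show ?case using norm_triangle_sub[of "f x" "f x0"] by (auto simp: M_def dist_norm)
  qed
  then obtain e where e: "e > 0" "\<And>x. dist x x0 < e \<Longrightarrow> norm (f x) \<le> M \<and> x \<in> U"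
    unfolding eventually_nhds_metric by blast
  \<comment> \<open>A disc of radius \<open>r\<close> about a point closer than \<open>r\<close> to
    \<open>x0\<close> stays within distance \<open>e\<close> of \<open>x0\<close>.\<close>
  define r where "r = e / 3"
  have r: "r > 0" using e by (simp add: r_def)
  have bound: "norm (a $ i) \<le> M / r" if x: "dist x x0 < r"
    and a: "(f has_derivative (\<lambda>v. \<Sum>i\<in>UNIV. a $ i * v $ i)) (at x)" for x a i
  proof -
    define g where "g s = f (x + s *s axis i 1)" for s
    have near: "dist (x + s *s axis i 1) x0 < e" if "norm s \<le> r" for s
    proof -
      have "norm (x + s *s axis i 1 - x0) \<le> norm (x - x0) + norm (s *s (axis i 1 :: complex ^ 'n))"
        using norm_triangle_ineq[of "x - x0" "s *s axis i 1"] by (simp add: algebra_simps)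
      also have "\<dots> < r + r" using x that by (simp add: norm_smult_vec dist_norm)
      finally show ?thesis using e by (simp add: dist_norm r_def)
    qed
    have fd: "g field_differentiable (at s)" if s: "norm s \<le> r" for s
    proof -
      obtain b where "(f has_derivative (\<lambda>v. \<Sum>i\<in>UNIV. b $ i * v $ i)) (at (x + s *s axis i 1))"
        using f conjunct2[OF e(2)[OF near[OF s]]] unfolding holomorphic_fun_def by metis
      from DERIV_line[OF this] show ?thesis
        unfolding g_def field_differentiable_def by blast
    qed
    have "(g has_field_derivative a $ i) (at 0)"
      using DERIV_line[of f a x 0 "axis i 1"] a
      by (simp add: g_def[abs_def] axis_def if_distrib cong: if_cong)
    then have "deriv g 0 = a $ i" by (rule DERIV_imp_deriv)
    moreover have "norm ((deriv ^^ 1) g 0) \<le> fact 1 * M / r ^ 1"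
    proof (rule Cauchy_inequality)
      show "g holomorphic_on ball 0 r"
        by (rule holomorphic_onI) (auto intro!: field_differentiable_at_within fd)
      show "continuous_on (cball 0 r) g"
        by (intro continuous_at_imp_continuous_on ballI field_differentiable_imp_continuous_at fd) auto
      show "norm (g s) \<le> M" if "norm (0 - s) = r" for s
        using e(2)[OF near[of s]] that by (simp add: g_def)
    qed (use r in auto)
    ultimately show ?thesis by simp
  qed
  have "\<forall>\<^sub>F x in nhds x0. dist x x0 < r"
    using r eventually_nhds_metric by blast
  then have "\<forall>\<^sub>F x in nhds x0. norm (f x) \<le> max M (M / r) \<and>
    (\<forall>a. (f has_derivative (\<lambda>v. \<Sum>i\<in>UNIV. a $ i * v $ i)) (at x) \<longrightarrow> (\<forall>i. norm (a $ i) \<le> max M (M / r)))"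
  proof eventually_elim
    case (elim x)
    moreover from elim have "norm (f x) \<le> M" using e by (simp add: r_def)
    ultimately show ?case using bound by (auto simp: le_max_iff_disj)
  qed
  then show ?thesis by blast
qed

lemma holomorphic_fun_bounded_along:
  fixes f :: "complex ^ 'n::finite \<Rightarrow> complex"
  assumes "holomorphic_fun f U" "open U" "x0 \<in> U" "(g \<longlongrightarrow> x0) net"
  shows "\<exists>B. \<forall>\<^sub>F t in net. norm (f (g t)) \<le> B \<and>
    (\<forall>a. (f has_derivative (\<lambda>v. \<Sum>i\<in>UNIV. a $ i * v $ i)) (at (g t)) \<longrightarrow> (\<forall>i. norm (a $ i) \<le> B))"
proof -
  obtain B where "\<forall>\<^sub>F x in nhds x0. norm (f x) \<le> B \<and>
      (\<forall>a. (f has_derivative (\<lambda>v. \<Sum>i\<in>UNIV. a $ i * v $ i)) (at x) \<longrightarrow> (\<forall>i. norm (a $ i) \<le> B))"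
    using holomorphic_fun_locally_bounded[OF assms(1-3)] by (rule exE)
  from eventually_compose_filterlim[OF this assms(4)] show ?thesis by (rule exI)
qed

subsection \<open>Singularities of type A\<close>

text \<open>Since \<open>\<phi> (\<zeta> x)\<close> is a multiple of \<open>x\<close>, homogeneity gives
  \<open>(\<phi> (\<zeta> x))\<^sub>j\<^sup>d F(x) = x\<^sub>j\<^sup>d (F \<circ> \<phi>)(\<zeta> x)\<close>; the formula is the \<open>i\<close>-th partial derivative of this
  identity.\<close>

lemma local_equation_derivative:
  fixes t :: real
  assumes F: "homogeneous d F" and "d \<ge> 1"
    and lc: "local_coordinates p W \<zeta> U \<phi>"
    and eq: "\<And>z. z \<in> U \<Longrightarrow> peval F (\<phi> z) = u z * ((z $ 1)\<^sup>2 + (z $ 2)\<^sup>2 + (z $ 3) ^ d)"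
    and z: "axis 3 (of_real t) \<in> U" and x: "x = \<phi> (axis 3 (of_real t))"
    and nz: "x $ j \<noteq> 0"
    and K: "\<And>l. ((\<lambda>x. \<zeta> x $ l) has_derivative (\<lambda>v. \<Sum>i\<in>UNIV. K l $ i * v $ i)) (at x)"
    and J: "((\<lambda>z. \<phi> z $ j) has_derivative (\<lambda>v. \<Sum>i\<in>UNIV. J $ i * v $ i)) (at (axis 3 (of_real t)))"
    and au: "(u has_derivative (\<lambda>v. \<Sum>i\<in>UNIV. au $ i * v $ i)) (at (axis 3 (of_real t)))"
  shows "peval (partial_deriv i F) x = of_real t ^ (d - 1) *
    (of_nat d * (axis i 1 $ j - (\<Sum>l\<in>UNIV. J $ l * K l $ i)) * u (axis 3 (of_real t)) * of_real t / x $ j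
     + (\<Sum>l\<in>UNIV. au $ l * K l $ i) * of_real t + of_nat d * K 3 $ i * u (axis 3 (of_real t)))"
proof -
  let ?z = "axis 3 (of_real t) :: complex ^ 3"
  let ?X = "\<lambda>s. x + s *s axis i 1"
  have W: "open W" and \<zeta>x: "\<zeta> x = ?z" and xW: "x \<in> W"
    using lc z x by (auto simp: local_coordinates_def)
  have dvec: "(\<Sum>i'\<in>UNIV. a $ i' * (axis i 1 :: complex ^ 4) $ i') = a $ i" for a :: "complex ^ 4"
    by (simp add: axis_def if_distrib cong: if_cong)
  have dZ: "((\<lambda>s. \<zeta> (?X s) $ l) has_field_derivative K l $ i) (at 0)" for l
    using DERIV_line[of "\<lambda>x. \<zeta> x $ l" "K l" x 0 "axis i 1"] K[of l] by (simp add: dvec)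
  define \<pi> where "\<pi> = (\<Sum>l\<in>UNIV. J $ l * K l $ i)"
  define \<upsilon> where "\<upsilon> = (\<Sum>l\<in>UNIV. au $ l * K l $ i)"
  have dP: "((\<lambda>s. \<phi> (\<zeta> (?X s)) $ j) has_field_derivative \<pi>) (at 0)"
    unfolding \<pi>_def
    by (rule DERIV_compose_vec[of "\<lambda>s. \<zeta> (?X s)" _ 0 "\<lambda>z. \<phi> z $ j", OF dZ]) (use J \<zeta>x in simp)
  have dU: "((\<lambda>s. u (\<zeta> (?X s))) has_field_derivative \<upsilon>) (at 0)"
    unfolding \<upsilon>_def
    by (rule DERIV_compose_vec[of "\<lambda>s. \<zeta> (?X s)" _ 0 u, OF dZ]) (use au \<zeta>x in simp)
  note dF = DERIV_peval_line[of F x i]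
  have dX: "((\<lambda>s. ?X s $ j) has_field_derivative axis i 1 $ j) (at 0)"
    by (auto intro!: derivative_eq_intros)
  let ?Q = "\<lambda>s. (\<zeta> (?X s) $ 1)\<^sup>2 + (\<zeta> (?X s) $ 2)\<^sup>2 + (\<zeta> (?X s) $ 3) ^ d"
  \<comment> \<open>On the third axis the first two local coordinates are 0, so the squares
    contribute nothing to first order.\<close>
  have dQ: "(?Q has_field_derivative of_nat d * of_real t ^ (d - 1) * K 3 $ i) (at 0)"
    by (rule derivative_eq_intros dZ refl)+ (simp add: \<zeta>x axis_def)
  let ?L = "\<lambda>s. (\<phi> (\<zeta> (?X s)) $ j) ^ d * peval F (?X s)"
  let ?R = "\<lambda>s. (?X s $ j) ^ d * (u (\<zeta> (?X s)) * ?Q s)"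
  have LR: "?L s = ?R s" if "?X s \<in> W" for s
  proof -
    have "\<zeta> (?X s) \<in> U" "\<phi> (\<zeta> (?X s)) \<in> vec.span {?X s}"
      using lc that by (auto simp: local_coordinates_def)
    \<comment> \<open>Nothing is known about how \<open>c\<close> depends on \<open>s\<close>. It is
      eliminated by expressing it both through the degree of \<open>F\<close> and through coordinate
      \<open>j\<close>, which leaves an identity between differentiable functions.\<close>
    then obtain c where c: "\<phi> (\<zeta> (?X s)) = c *s ?X s"
      unfolding vec.span_singleton by auto
    have "u (\<zeta> (?X s)) * ?Q s = c ^ d * peval F (?X s)"
      unfolding eq[OF \<open>\<zeta> (?X s) \<in> U\<close>, symmetric] c peval_scale[OF F] ..
    moreover have "\<phi> (\<zeta> (?X s)) $ j = c * (?X s $ j)" unfolding c by (simp only: vector_smult_component)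
    ultimately show ?thesis by (simp only: power_mult_distrib mult_ac)
  qed
  have near: "\<forall>\<^sub>F s in nhds 0. ?L s = ?R s"
  proof -
    have "((\<lambda>s. ?X s) \<longlongrightarrow> ?X 0) (nhds 0)"
      by (intro vec_tendstoI) (auto intro!: tendsto_eq_intros filterlim_ident)
    then have "\<forall>\<^sub>F s in nhds 0. ?X s \<in> W"
      using W xW by (intro topological_tendstoD) auto
    then show ?thesis by eventually_elim (rule LR)
  qed
  have dL: "(?L has_field_derivative
      of_nat d * (x $ j) ^ (d - 1) * \<pi> * peval F x + (x $ j) ^ d * peval (partial_deriv i F) x) (at 0)"
    by (rule derivative_eq_intros dP dF refl)+ (simp add: \<zeta>x flip: x)
  have dR: "(?R has_field_derivative
      of_nat d * (x $ j) ^ (d - 1) * axis i 1 $ j * (u ?z * of_real t ^ d) +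
      (x $ j) ^ d * (\<upsilon> * of_real t ^ d + u ?z * (of_nat d * of_real t ^ (d - 1) * K 3 $ i))) (at 0)"
    by (rule derivative_eq_intros dX dU dQ refl)+ (use \<open>d \<ge> 1\<close> in \<open>simp add: \<zeta>x axis_def\<close>)
  have Fx: "peval F x = u ?z * of_real t ^ d"
    unfolding x eq[OF z] using \<open>d \<ge> 1\<close> by (simp add: axis_def)
  have "of_nat d * (x $ j) ^ (d - 1) * \<pi> * peval F x + (x $ j) ^ d * peval (partial_deriv i F) x =
      of_nat d * (x $ j) ^ (d - 1) * axis i 1 $ j * (u ?z * of_real t ^ d) +
      (x $ j) ^ d * (\<upsilon> * of_real t ^ d + u ?z * (of_nat d * of_real t ^ (d - 1) * K 3 $ i))"
    using dL dR DERIV_cong_ev[OF refl near refl] DERIV_unique by blast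
  moreover obtain n where n: "d = Suc n" using \<open>d \<ge> 1\<close> by (cases d) auto
  ultimately have "(x $ j) ^ n * (x $ j * peval (partial_deriv i F) x) =
      (x $ j) ^ n * (of_nat d * (axis i 1 $ j - \<pi>) * (u ?z * of_real t ^ d) +
       x $ j * (\<upsilon> * of_real t ^ d + u ?z * (of_nat d * of_real t ^ n * K 3 $ i)))"
    unfolding Fx by (simp add: algebra_simps)
  then have "x $ j * peval (partial_deriv i F) x =
      of_nat d * (axis i 1 $ j - \<pi>) * (u ?z * of_real t ^ d) +
       x $ j * (\<upsilon> * of_real t ^ d + u ?z * (of_nat d * of_real t ^ n * K 3 $ i))"
    using nz by simp
  then show ?thesis
    unfolding \<pi>_def[symmetric] \<upsilon>_def[symmetric] using nz
    by (simp add: n field_simps)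
qed


text \<open>The curve is the \<open>z\<^sub>3\<close>-axis of the local coordinates; its existence is all that is used of an
  \<open>A\<^bsub>d-1\<^esub>\<close>-singularity.\<close>

lemma A_singularity_curve:
  fixes F :: "4 cpoly"
  assumes F: "homogeneous d F" and "d \<ge> 1" and sing: "A_singularity (d - 1) F p"
  obtains \<gamma> :: "real \<Rightarrow> complex ^ 4" and v where
    "\<gamma> 0 \<in> p" "\<gamma> 0 \<noteq> 0" "(\<gamma> has_vector_derivative v) (at 0)" "v \<notin> vec.span {\<gamma> 0}"
    "\<forall>i. \<exists>C. \<forall>\<^sub>F t in nhds 0. norm (peval (partial_deriv i F) (\<gamma> t)) \<le> C * \<bar>t\<bar> ^ (d - 1)"
proof -
  obtain W \<zeta> U \<phi> u where lc: "local_coordinates p W \<zeta> U \<phi>" and u: "holomorphic_fun u U"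
    and eq: "\<And>z. z \<in> U \<Longrightarrow> peval F (\<phi> z) = u z * ((z $ 1)\<^sup>2 + (z $ 2)\<^sup>2 + (z $ 3) ^ d)"
    using sing \<open>d \<ge> 1\<close> unfolding A_singularity_def by auto
  from sing obtain x0 where p: "p = vec.span {x0}" and "x0 \<noteq> 0"
    by (auto simp: A_singularity_def zero_locus_def proj_space_def)
  then have x0: "x0 \<in> p - {0}" by (auto simp: vec.span_base)
  have W: "open W" "0 \<notin> W" and U: "open U"
    and h\<zeta>: "\<And>l. holomorphic_fun (\<lambda>x. \<zeta> x $ l) W" and h\<phi>: "\<And>i. holomorphic_fun (\<lambda>z. \<phi> z $ i) U"
    and \<zeta>W: "\<And>x. x \<in> W \<Longrightarrow> \<zeta> x \<in> U \<and> \<phi> (\<zeta> x) \<in> vec.span {x}"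
    and \<phi>U: "\<And>z. z \<in> U \<Longrightarrow> \<phi> z \<in> W \<and> \<zeta> (\<phi> z) = z"
    and x0W: "x0 \<in> W" "\<zeta> x0 = 0"
    and scale: "\<And>x c. x \<in> W \<Longrightarrow> c \<noteq> 0 \<Longrightarrow> \<zeta> (c *s x) = \<zeta> x"
    using lc x0 unfolding local_coordinates_def by auto
  have U0: "0 \<in> U" using \<zeta>W[OF x0W(1)] x0W(2) by simp
  let ?z = "\<lambda>t::real. axis 3 (of_real t) :: complex ^ 3"
  define \<gamma> where "\<gamma> t = \<phi> (?z t)" for t
  have z00: "axis 3 0 = (0 :: complex ^ 3)" by (simp add: axis_def vec_eq_iff)
  then have z0: "?z 0 = 0" by simp
  have \<gamma>0: "\<gamma> 0 \<in> p" "\<gamma> 0 \<noteq> 0" "\<gamma> 0 \<in> W"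
    unfolding \<gamma>_def z0 p using conjunct2[OF \<zeta>W[OF x0W(1), unfolded x0W(2)]] conjunct1[OF \<phi>U[OF U0]] W(2)
    by (simp, metis, simp)
  \<comment> \<open>The derivative coefficients are chosen point by point; only their boundedness
    near the base point is used, and it holds for every choice.\<close>
  define K where "K x l = (SOME a. ((\<lambda>x. \<zeta> x $ l) has_derivative (\<lambda>v. \<Sum>i\<in>UNIV. a $ i * v $ i)) (at x))"
    for x l
  have K: "((\<lambda>x. \<zeta> x $ l) has_derivative (\<lambda>v. \<Sum>i\<in>UNIV. K x l $ i * v $ i)) (at x)" if "x \<in> W" for x l
    unfolding K_def by (rule someI_ex) (use h\<zeta>[of l] that in \<open>auto simp: holomorphic_fun_def\<close>)
  define J where "J x j = (SOME a. ((\<lambda>z. \<phi> z $ j) has_derivative (\<lambda>v. \<Sum>i\<in>UNIV. a $ i * v $ i)) (at x))"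
    for x j
  have J: "((\<lambda>z. \<phi> z $ j) has_derivative (\<lambda>v. \<Sum>i\<in>UNIV. J x j $ i * v $ i)) (at x)" if "x \<in> U" for x j
    unfolding J_def by (rule someI_ex) (use h\<phi>[of j] that in \<open>auto simp: holomorphic_fun_def\<close>)
  define au where "au x = (SOME a. (u has_derivative (\<lambda>v. \<Sum>i\<in>UNIV. a $ i * v $ i)) (at x))"
    for x
  have au: "(u has_derivative (\<lambda>v. \<Sum>i\<in>UNIV. au x $ i * v $ i)) (at x)" if "x \<in> U" for x
    unfolding au_def by (rule someI_ex) (use u that in \<open>auto simp: holomorphic_fun_def\<close>)
  have dz: "(?z has_derivative (\<lambda>h. ?z h)) (at t)" for t
  proof (rule has_derivative_vecI)
    fix l :: 3
    have "((\<lambda>t. if l = 3 then complex_of_real t else 0) has_derivative (\<lambda>h. if l = 3 then complex_of_real h else 0)) (at t)"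
      by (cases "l = 3") (auto intro!: derivative_eq_intros)
    then show "((\<lambda>t. ?z t $ l) has_derivative (\<lambda>h. ?z h $ l)) (at t)"
      by (simp add: axis_def)
  qed
  define v where "v = (\<chi> i. J 0 i $ 3)"
  have d\<gamma>: "(\<gamma> has_vector_derivative v) (at 0)"
    unfolding has_vector_derivative_def
  proof (rule has_derivative_vecI)
    fix i
    have "((\<lambda>t. \<phi> (?z t) $ i) has_derivative (\<lambda>h. \<Sum>l\<in>UNIV. J 0 i $ l * ?z h $ l)) (at 0)"
      by (rule has_derivative_compose[OF dz, of "\<lambda>z. \<phi> z $ i"]) (use J[OF U0] in \<open>simp add: z00\<close>)
    moreover have "(\<Sum>l\<in>UNIV. J 0 i $ l * ?z h $ l) = (h *\<^sub>R v) $ i" for h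
      unfolding vector_scaleR_component unfolding scaleR_conv_of_real
      by (simp add: axis_def v_def if_distrib mult.commute cong: if_cong)
    ultimately show "((\<lambda>t. \<gamma> t $ i) has_derivative (\<lambda>h. (h *\<^sub>R v) $ i)) (at 0)"
      by (simp add: \<gamma>_def)
  qed
  have z_tendsto: "(?z \<longlongrightarrow> 0) (nhds 0)"
    using has_derivative_continuous[OF dz, of 0] by (simp add: z00 continuous_at tendsto_nhds_iff)
  have \<gamma>_tendsto: "(\<gamma> \<longlongrightarrow> \<gamma> 0) (nhds 0)"
    using has_derivative_continuous[OF d\<gamma>[unfolded has_vector_derivative_def]]
    by (simp add: continuous_at tendsto_nhds_iff)
  \<comment> \<open>The third coordinate function is constant on the punctured line through
    \<open>\<gamma> 0\<close>, so its differential kills \<open>\<gamma> 0\<close>; but it equals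
    \<open>t\<close> along the curve, so its differential takes the value 1 on
    \<open>v\<close>.\<close>
  have nspan: "v \<notin> vec.span {\<gamma> 0}"
  proof
    assume "v \<in> vec.span {\<gamma> 0}"
    then obtain c where c: "v = c *s \<gamma> 0"
      unfolding vec.span_singleton by auto
    have K0: "((\<lambda>s. \<zeta> (\<gamma> 0 + s *s \<gamma> 0) $ 3) has_field_derivative (\<Sum>i\<in>UNIV. K (\<gamma> 0) 3 $ i * \<gamma> 0 $ i)) (at 0)"
      by (rule DERIV_line) (use K[OF \<gamma>0(3)] in simp)
    have "\<forall>\<^sub>F s :: complex in nhds 0. \<zeta> (\<gamma> 0 + s *s \<gamma> 0) $ 3 = \<zeta> (\<gamma> 0) $ 3"
    proof -
      have "\<forall>\<^sub>F s :: complex in nhds 0. s \<in> - {-1}"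
        by (rule eventually_nhds_in_open) auto
      then show ?thesis
      proof eventually_elim
        case (elim s)
        then have "1 + s \<noteq> 0" by (auto simp: add_eq_0_iff)
        moreover have "\<gamma> 0 + s *s \<gamma> 0 = (1 + s) *s \<gamma> 0" by (simp add: vec.scale_left_distrib)
        ultimately show ?case using scale[OF \<gamma>0(3)] by metis
      qed
    qed
    then have "((\<lambda>s. \<zeta> (\<gamma> 0) $ 3) has_field_derivative (\<Sum>i\<in>UNIV. K (\<gamma> 0) 3 $ i * \<gamma> 0 $ i)) (at 0)"
      using K0 DERIV_cong_ev[OF refl _ refl] by fast
    then have 1: "(\<Sum>i\<in>UNIV. K (\<gamma> 0) 3 $ i * \<gamma> 0 $ i) = 0"
      using DERIV_unique DERIV_const by blast
    have "((\<lambda>t. \<zeta> (\<gamma> t) $ 3) has_derivative (\<lambda>h. \<Sum>i\<in>UNIV. K (\<gamma> 0) 3 $ i * (h *\<^sub>R v) $ i)) (at 0)"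
      by (rule has_derivative_compose[OF d\<gamma>[unfolded has_vector_derivative_def], of "\<lambda>x. \<zeta> x $ 3"])
         (use K[OF \<gamma>0(3)] in simp)
    moreover have "((\<lambda>t. \<zeta> (\<gamma> t) $ 3) has_derivative (\<lambda>h. complex_of_real h)) (at 0)"
    proof -
      have "\<forall>\<^sub>F t in nhds 0. ?z t \<in> U"
        using U U0 by (intro topological_tendstoD[OF z_tendsto]) auto
      then have ev: "\<forall>\<^sub>F t in nhds 0. \<zeta> (\<gamma> t) $ 3 = complex_of_real t"
        by eventually_elim (simp add: \<gamma>_def \<phi>U axis_def)
      have "((\<lambda>t. complex_of_real t) has_derivative (\<lambda>h. complex_of_real h)) (at 0)"
        by (auto intro!: derivative_eq_intros)
      then show ?thesis
      proof (rule has_derivative_transform_eventually)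
        show "\<forall>\<^sub>F t in at 0. complex_of_real t = \<zeta> (\<gamma> t) $ 3"
          using ev by (auto simp: eventually_at_filter elim: eventually_mono)
        show "complex_of_real 0 = \<zeta> (\<gamma> 0) $ 3"
          using eventually_nhds_x_imp_x[OF ev] by simp
      qed simp
    qed
    ultimately have "(\<lambda>h. \<Sum>i\<in>UNIV. K (\<gamma> 0) 3 $ i * (h *\<^sub>R v) $ i) = complex_of_real"
      by (rule has_derivative_unique)
    from fun_cong[OF this, of 1] have "(\<Sum>i\<in>UNIV. K (\<gamma> 0) 3 $ i * (c * \<gamma> 0 $ i)) = 1"
      by (simp add: c)
    moreover have "(\<Sum>i\<in>UNIV. K (\<gamma> 0) 3 $ i * (c * \<gamma> 0 $ i)) = c * (\<Sum>i\<in>UNIV. K (\<gamma> 0) 3 $ i * \<gamma> 0 $ i)"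
      by (simp add: sum_distrib_left mult_ac)
    ultimately show False using 1 by simp
  qed
  obtain j where j: "\<gamma> 0 $ j \<noteq> 0"
    using \<gamma>0(2) by (auto simp: vec_eq_iff)
  \<comment> \<open>Lower bound near \<open>t = 0\<close> for the modulus of the denominator
    \<open>x $ j\<close> in \<open>local_equation_derivative\<close>.\<close>
  define \<eta> where "\<eta> = norm (\<gamma> 0 $ j) / 2"
  have \<eta>: "\<eta> > 0" using j by (simp add: \<eta>_def)
  have ev\<eta>: "\<forall>\<^sub>F t in nhds 0. \<eta> < norm (\<gamma> t $ j)"
    by (rule order_tendstoD[OF tendsto_norm[OF tendsto_vec_nth[OF \<gamma>_tendsto]]]) (use j in \<open>simp add: \<eta>_def\<close>)
  have evU: "\<forall>\<^sub>F t in nhds 0. ?z t \<in> U"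
    using U U0 by (intro topological_tendstoD[OF z_tendsto]) auto
  obtain Bu where Bu: "\<forall>\<^sub>F t in nhds 0. norm (u (?z t)) \<le> Bu \<and>
      (\<forall>a. (u has_derivative (\<lambda>v. \<Sum>i\<in>UNIV. a $ i * v $ i)) (at (?z t)) \<longrightarrow> (\<forall>i. norm (a $ i) \<le> Bu))"
    using holomorphic_fun_bounded_along[OF u U U0 z_tendsto] by (rule exE)
  obtain BJ where BJ: "\<forall>\<^sub>F t in nhds 0. norm (\<phi> (?z t) $ j) \<le> BJ \<and>
      (\<forall>a. ((\<lambda>z. \<phi> z $ j) has_derivative (\<lambda>v. \<Sum>i\<in>UNIV. a $ i * v $ i)) (at (?z t)) \<longrightarrow> (\<forall>i. norm (a $ i) \<le> BJ))"
    using holomorphic_fun_bounded_along[OF h\<phi> U U0 z_tendsto] by (rule exE)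
  have "\<forall>l. \<exists>B. \<forall>\<^sub>F t in nhds 0. norm (\<zeta> (\<gamma> t) $ l) \<le> B \<and>
      (\<forall>a. ((\<lambda>x. \<zeta> x $ l) has_derivative (\<lambda>v. \<Sum>i\<in>UNIV. a $ i * v $ i)) (at (\<gamma> t)) \<longrightarrow> (\<forall>i. norm (a $ i) \<le> B))"
    by (rule allI, rule holomorphic_fun_bounded_along[OF h\<zeta> W(1) \<gamma>0(3) \<gamma>_tendsto])
  from choice[OF this] obtain BK where BK: "\<forall>l. \<forall>\<^sub>F t in nhds 0. norm (\<zeta> (\<gamma> t) $ l) \<le> BK l \<and>
      (\<forall>a. ((\<lambda>x. \<zeta> x $ l) has_derivative (\<lambda>v. \<Sum>i\<in>UNIV. a $ i * v $ i)) (at (\<gamma> t)) \<longrightarrow> (\<forall>i. norm (a $ i) \<le> BK l))"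
    by (rule exE)
  have "\<exists>C. \<forall>\<^sub>F t in nhds 0. norm (peval (partial_deriv i F) (\<gamma> t)) \<le> C * \<bar>t\<bar> ^ (d - 1)" for i
  proof -
    \<comment> \<open>Term-by-term bound for the second factor in
      \<open>local_equation_derivative\<close>: the factors 1 come from
      \<open>\<bar>t\<bar> < 1\<close>, the summand 1 from the entry of
      \<open>axis i 1\<close>.\<close>
    define C where "C = d * (1 + (\<Sum>l\<in>UNIV. BJ * BK l)) * Bu * 1 / \<eta> + (\<Sum>l\<in>UNIV. Bu * BK l) * 1 + d * BK 3 * Bu"
    have small: "\<forall>\<^sub>F t in nhds 0. \<bar>t\<bar> < (1::real)"
      unfolding eventually_nhds_metric by (auto simp: dist_real_def intro!: exI[of _ 1])
    have allBK: "\<forall>\<^sub>F t in nhds 0. \<forall>l. norm (\<zeta> (\<gamma> t) $ l) \<le> BK l \<and>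
      (\<forall>a. ((\<lambda>x. \<zeta> x $ l) has_derivative (\<lambda>v. \<Sum>i\<in>UNIV. a $ i * v $ i)) (at (\<gamma> t)) \<longrightarrow> (\<forall>i. norm (a $ i) \<le> BK l))"
      by (rule eventually_all_finite) (rule BK[THEN spec])
    have "\<forall>\<^sub>F t in nhds 0. norm (peval (partial_deriv i F) (\<gamma> t)) \<le> C * \<bar>t\<bar> ^ (d - 1)"
      using small allBK BJ Bu ev\<eta> evU
    proof eventually_elim
      case (elim t)
      have zU: "?z t \<in> U" by fact
      have \<gamma>W: "\<gamma> t \<in> W" using \<phi>U[OF zU] by (simp add: \<gamma>_def)
      have b1: "norm (K (\<gamma> t) l $ i) \<le> BK l" for l by (rule elim(2)[THEN spec, THEN conjunct2, THEN spec, THEN mp, OF K[OF \<gamma>W], THEN spec])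
      have b2: "norm (J (?z t) j $ l) \<le> BJ" for l by (rule elim(3)[THEN conjunct2, THEN spec, THEN mp, OF J[OF zU], THEN spec])
      have b3: "norm (au (?z t) $ l) \<le> Bu" for l by (rule elim(4)[THEN conjunct2, THEN spec, THEN mp, OF au[OF zU], THEN spec])
      have b4: "norm (u (?z t)) \<le> Bu" by (rule elim(4)[THEN conjunct1])
      have nn: "BK l \<ge> 0" "BJ \<ge> 0" "Bu \<ge> 0" for l
        using order.trans[OF norm_ge_zero b1] order.trans[OF norm_ge_zero b2] order.trans[OF norm_ge_zero b4] by auto
      have ax: "norm (axis i 1 $ j :: complex) \<le> 1" by (simp add: axis_def)
      have s1: "norm (\<Sum>l\<in>UNIV. J (?z t) j $ l * K (\<gamma> t) l $ i) \<le> (\<Sum>l\<in>UNIV. BJ * BK l)"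
        by (intro sum_norm_le) (auto simp: norm_mult intro!: mult_mono b1 b2 nn)
      have s2: "norm (\<Sum>l\<in>UNIV. au (?z t) $ l * K (\<gamma> t) l $ i) \<le> (\<Sum>l\<in>UNIV. Bu * BK l)"
        by (intro sum_norm_le) (auto simp: norm_mult intro!: mult_mono b1 b3 nn)
      have "norm (of_nat d * (axis i 1 $ j - (\<Sum>l\<in>UNIV. J (?z t) j $ l * K (\<gamma> t) l $ i)) * u (?z t) * of_real t / \<gamma> t $ j
          + (\<Sum>l\<in>UNIV. au (?z t) $ l * K (\<gamma> t) l $ i) * of_real t + of_nat d * K (\<gamma> t) 3 $ i * u (?z t)) \<le> C"
        unfolding C_def
      proof (intro norm_triangle_mono)
        have "norm (axis i 1 $ j - (\<Sum>l\<in>UNIV. J (?z t) j $ l * K (\<gamma> t) l $ i)) \<le> 1 + (\<Sum>l\<in>UNIV. BJ * BK l)"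
          using norm_triangle_ineq4 ax s1 by (meson add_mono order.trans)
        then show "norm (of_nat d * (axis i 1 $ j - (\<Sum>l\<in>UNIV. J (?z t) j $ l * K (\<gamma> t) l $ i)) * u (?z t) * of_real t / \<gamma> t $ j)
            \<le> d * (1 + (\<Sum>l\<in>UNIV. BJ * BK l)) * Bu * 1 / \<eta>"
          unfolding norm_divide norm_mult norm_of_nat norm_of_real
          using elim(1,5) \<eta> nn b4
          by (intro frac_le mult_mono mult_nonneg_nonneg add_nonneg_nonneg sum_nonneg) auto
        show "norm ((\<Sum>l\<in>UNIV. au (?z t) $ l * K (\<gamma> t) l $ i) * of_real t) \<le> (\<Sum>l\<in>UNIV. Bu * BK l) * 1"
          unfolding norm_mult norm_of_real
          using elim(1) s2 nn by (intro mult_mono sum_nonneg mult_nonneg_nonneg) auto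
        show "norm (of_nat d * K (\<gamma> t) 3 $ i * u (?z t)) \<le> d * BK 3 * Bu"
          unfolding norm_mult norm_of_nat
          using b1 b4 nn by (intro mult_mono mult_nonneg_nonneg) auto
      qed
      then have "\<bar>t\<bar> ^ (d - 1) * norm (of_nat d * (axis i 1 $ j - (\<Sum>l\<in>UNIV. J (?z t) j $ l * K (\<gamma> t) l $ i)) * u (?z t) * of_real t / \<gamma> t $ j
          + (\<Sum>l\<in>UNIV. au (?z t) $ l * K (\<gamma> t) l $ i) * of_real t + of_nat d * K (\<gamma> t) 3 $ i * u (?z t)) \<le> \<bar>t\<bar> ^ (d - 1) * C"
        by (intro mult_left_mono) auto
      moreover have "\<gamma> t $ j \<noteq> 0" using elim(5) \<eta> by auto
      ultimately show ?case
        by (subst local_equation_derivative[OF F \<open>d \<ge> 1\<close> lc eq zU \<gamma>_def _ K[OF \<gamma>W] J[OF zU] au[OF zU]])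
           (auto simp: norm_mult norm_power mult.commute)
    qed
    then show ?thesis by blast
  qed
  then show thesis using that \<gamma>0(1,2) d\<gamma> nspan by blast
qed

section \<open>Vanishing order of the gradient along a curve\<close>

lemma has_vector_derivative_tendsto:
  fixes f :: "real \<Rightarrow> complex"
  assumes "(f has_vector_derivative D) (at 0)"
  shows "((\<lambda>t. (f t - f 0) / of_real t) \<longlongrightarrow> D) (at 0)"
proof -
  have "((\<lambda>h. norm (f h - f 0 - h *\<^sub>R D) / norm h) \<longlongrightarrow> 0) (at 0)"
    using assms by (simp add: has_vector_derivative_def has_derivative_at)
  moreover have "\<forall>\<^sub>F h in at 0. norm (f h - f 0 - h *\<^sub>R D) / norm h = norm ((f h - f 0) / of_real h - D)"
    unfolding eventually_at_filter
  proof (rule always_eventually, intro allI impI)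
    fix h :: real assume "h \<noteq> 0"
    then have "(f h - f 0) / of_real h - D = (f h - f 0 - h *\<^sub>R D) / of_real h"
      by (simp add: scaleR_conv_of_real field_simps)
    then show "norm (f h - f 0 - h *\<^sub>R D) / norm h = norm ((f h - f 0) / of_real h - D)"
      by (simp add: norm_divide)
  qed
  ultimately have "((\<lambda>h. norm ((f h - f 0) / of_real h - D)) \<longlongrightarrow> 0) (at 0)"
    using tendsto_cong by fast
  then show ?thesis
    using Lim_null tendsto_norm_zero_iff by blast
qed

lemma partial_deriv_decomposition:
  fixes G A g :: "4 cpoly"
  assumes G: "\<And>x. peval G x = (x $ 3) ^ m * peval A x + x $ 4 * peval g x"
  shows "peval (partial_deriv i G) x =
    of_nat m * axis i 1 $ 3 * (x $ 3) ^ (m - 1) * peval A x + (x $ 3) ^ m * peval (partial_deriv i A) x +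
    axis i 1 $ 4 * peval g x + x $ 4 * peval (partial_deriv i g) x"
proof (rule DERIV_unique)
  show "((\<lambda>s. peval G (x + s *s axis i 1)) has_field_derivative peval (partial_deriv i G) x) (at 0)"
    by (rule DERIV_peval_line)
  show "((\<lambda>s. peval G (x + s *s axis i 1)) has_field_derivative 
    of_nat m * axis i 1 $ 3 * (x $ 3) ^ (m - 1) * peval A x + (x $ 3) ^ m * peval (partial_deriv i A) x +
    axis i 1 $ 4 * peval g x + x $ 4 * peval (partial_deriv i g) x) (at 0)"
  proof -
    have "((\<lambda>s. (x + s *s axis i 1) $ k) has_field_derivative axis i 1 $ k) (at 0)" for k
      by (auto intro!: derivative_eq_intros)
    note [derivative_intros] = this DERIV_peval_line
    show ?thesis
      unfolding G by (rule derivative_eq_intros refl)+ (simp add: algebra_simps)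
  qed
qed

text \<open>Along the curve the equation behaves like \<open>y\<^sup>m + z g\<close>. Eliminating \<open>z\<close> from the derivatives
  in the second and third direction leaves \<open>y\<^bsup>m-1\<^esup>\<close> times a unit, which therefore vanishes to an order
  greater than \<open>m - 1\<close>; hence \<open>y\<close>, then \<open>z\<close> and finally \<open>g\<close> vanish to second order.\<close>

lemma critical_curve_direction:
  fixes G A g :: "4 cpoly" and \<delta> :: "real \<Rightarrow> complex ^ 4"
  assumes G: "\<And>x. peval G x = (x $ 3) ^ m * peval A x + x $ 4 * peval g x"
    and m: "2 \<le> m" "m < d"
    and \<delta>: "(\<delta> has_vector_derivative w) (at 0)" "\<delta> 0 $ 3 = 0" "\<delta> 0 $ 4 = 0"
    and A0: "peval A (\<delta> 0) \<noteq> 0" and g0: "peval g (\<delta> 0) = 0"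
    and g2: "peval (partial_deriv 2 g) (\<delta> 0) \<noteq> 0"
    and bound: "\<And>i. \<exists>C. \<forall>\<^sub>F t in nhds 0. norm (peval (partial_deriv i G) (\<delta> t)) \<le> C * \<bar>t\<bar> ^ (d - 1)"
  shows "w $ 3 = 0" "w $ 4 = 0" "(\<Sum>i\<in>UNIV. peval (partial_deriv i g) (\<delta> 0) * w $ i) = 0"
proof -
  define E where "E i t = peval (partial_deriv i G) (\<delta> t)" for i t
  define A' where "A' i t = peval (partial_deriv i A) (\<delta> t)" for i t
  define g' where "g' i t = peval (partial_deriv i g) (\<delta> t)" for i t
  define y where "y t = \<delta> t $ 3" for t
  define z where "z t = \<delta> t $ 4" for t
  have E: "E i t = of_nat m * axis i 1 $ 3 * y t ^ (m - 1) * peval A (\<delta> t) + y t ^ m * A' i t +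
      axis i 1 $ 4 * peval g (\<delta> t) + z t * g' i t" for i t
    unfolding E_def y_def z_def A'_def g'_def by (rule partial_deriv_decomposition[OF G])
  \<comment> \<open>Here \<open>m < d\<close> enters: the quotients are needed for
    \<open>k = m - 1\<close> and \<open>k = 1\<close>, and both lie below \<open>d - 1\<close>
    because \<open>2 \<le> m\<close>.\<close>
  have small: "((\<lambda>t. E i t / of_real t ^ k) \<longlongrightarrow> 0) (at 0)" if k: "k < d - 1" for i k
  proof -
    obtain C where C: "\<forall>\<^sub>F t in nhds 0. norm (E i t) \<le> C * \<bar>t\<bar> ^ (d - 1)"
      using bound[of i] unfolding E_def by (rule exE)
    then have "\<forall>\<^sub>F t in at 0. norm (E i t / of_real t ^ k) \<le> C * \<bar>t\<bar> ^ (d - 1 - k)"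
      unfolding eventually_at_filter
    proof eventually_elim
      case (elim t)
      have "\<bar>t\<bar> ^ (d - 1) = \<bar>t\<bar> ^ (d - 1 - k) * \<bar>t\<bar> ^ k"
        using k by (simp flip: power_add)
      then show ?case using elim
        by (auto simp: norm_divide norm_power divide_simps mult.assoc)
    qed
    moreover have "((\<lambda>t. C * \<bar>t\<bar> ^ (d - 1 - k)) \<longlongrightarrow> 0) (at (0::real))"
      using k by (auto intro!: tendsto_eq_intros simp: power_0_left)
    ultimately show ?thesis by (rule Lim_null_comparison)
  qed
  have \<delta>_tendsto: "(\<delta> \<longlongrightarrow> \<delta> 0) (at 0)"
    using has_derivative_continuous[OF \<delta>(1)[unfolded has_vector_derivative_def]] by (simp add: isCont_def)
  have A't: "(A' i \<longlongrightarrow> A' i 0) (at 0)" and g't: "(g' i \<longlongrightarrow> g' i 0) (at 0)" for i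
    unfolding A'_def g'_def by (intro tendsto_peval \<delta>_tendsto)+
  have At: "((\<lambda>t. peval A (\<delta> t)) \<longlongrightarrow> peval A (\<delta> 0)) (at 0)"
    by (intro tendsto_peval \<delta>_tendsto)
  have yt: "(y \<longlongrightarrow> 0) (at 0)"
    using tendsto_vec_nth[OF \<delta>_tendsto, of 3] \<delta>(2) by (simp add: y_def[abs_def])
  have comp: "((\<lambda>t. \<delta> t $ i) has_vector_derivative w $ i) (at 0)" for i
    by (rule bounded_linear.has_vector_derivative[OF bounded_linear_vec_nth \<delta>(1)])
  have ydt: "((\<lambda>t. y t / of_real t) \<longlongrightarrow> w $ 3) (at 0)" and zdt: "((\<lambda>t. z t / of_real t) \<longlongrightarrow> w $ 4) (at 0)"
    using has_vector_derivative_tendsto[OF comp[of 3]] has_vector_derivative_tendsto[OF comp[of 4]] \<delta>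
    by (simp_all add: y_def[abs_def] z_def[abs_def])
  have gdt: "((\<lambda>t. peval g (\<delta> t) / of_real t) \<longlongrightarrow> (\<Sum>i\<in>UNIV. g' i 0 * w $ i)) (at 0)"
  proof -
    have "((\<lambda>t. peval g (\<delta> t)) has_derivative (\<lambda>h. \<Sum>i\<in>UNIV. g' i 0 * (h *\<^sub>R w) $ i)) (at 0)"
      unfolding g'_def by (rule has_derivative_compose[OF \<delta>(1)[unfolded has_vector_derivative_def] has_derivative_peval])
    moreover have "(\<Sum>i\<in>UNIV. g' i 0 * (h *\<^sub>R w) $ i) = h *\<^sub>R (\<Sum>i\<in>UNIV. g' i 0 * w $ i)" for h
      by (simp add: scaleR_sum_right)
    ultimately show ?thesis
      using has_vector_derivative_tendsto[of "\<lambda>t. peval g (\<delta> t)"] g0 by (simp add: has_vector_derivative_def)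
  qed
  obtain n where n: "m = Suc n" "n \<ge> 1" using m by (cases m) auto
  have w3: "w $ 3 = 0"
  proof -
    \<comment> \<open>The limit of this combination is found twice: it is 0 by \<open>small\<close>,
      and after the terms with \<open>z\<close> cancel it is \<open>(w $ 3) ^ n\<close> times a
      nonzero number.\<close>
    have "((\<lambda>t. g' 2 t * (E 3 t / of_real t ^ n) - g' 3 t * (E 2 t / of_real t ^ n)) \<longlongrightarrow> g' 2 0 * 0 - g' 3 0 * 0) (at 0)"
      using n m by (intro tendsto_intros g't small) auto
    moreover have "g' 2 t * (E 3 t / of_real t ^ n) - g' 3 t * (E 2 t / of_real t ^ n) =
        (y t / of_real t) ^ n * (of_nat m * peval A (\<delta> t) * g' 2 t + y t * (A' 3 t * g' 2 t - A' 2 t * g' 3 t))" for t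
    proof -
      have "g' 2 t * E 3 t - g' 3 t * E 2 t =
          y t ^ n * (of_nat m * peval A (\<delta> t) * g' 2 t + y t * (A' 3 t * g' 2 t - A' 2 t * g' 3 t))"
        unfolding E by (simp add: n axis_def algebra_simps)
      then have "(g' 2 t * E 3 t - g' 3 t * E 2 t) / of_real t ^ n =
          y t ^ n * (of_nat m * peval A (\<delta> t) * g' 2 t + y t * (A' 3 t * g' 2 t - A' 2 t * g' 3 t)) / of_real t ^ n"
        by simp
      then show ?thesis by (simp add: diff_divide_distrib power_divide)
    qed
    moreover have "((\<lambda>t. (y t / of_real t) ^ n * (of_nat m * peval A (\<delta> t) * g' 2 t + y t * (A' 3 t * g' 2 t - A' 2 t * g' 3 t)))
        \<longlongrightarrow> (w $ 3) ^ n * (of_nat m * peval A (\<delta> 0) * g' 2 0 + 0 * (A' 3 0 * g' 2 0 - A' 2 0 * g' 3 0))) (at 0)"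
      by (intro tendsto_intros ydt At g't A't yt)
    ultimately have "(w $ 3) ^ n * (of_nat m * peval A (\<delta> 0) * g' 2 0) = 0"
      using tendsto_unique[OF trivial_limit_at] by fastforce
    then show ?thesis using A0 g2 n by (simp add: g'_def del: of_nat_Suc)
  qed
  \<comment> \<open>The terms \<open>y t ^ m * A' i t\<close> thus disappear from
    \<open>E i t / t\<close> in the limit, which isolates \<open>z\<close> in direction 2 and
    \<open>g\<close> in direction 4.\<close>
  have ym: "((\<lambda>t. (y t / of_real t) * y t ^ n * A' i t) \<longlongrightarrow> 0 * 0 ^ n * A' i 0) (at 0)" for i
    using ydt w3 by (intro tendsto_intros yt A't) auto
  have w4: "w $ 4 = 0"
  proof -
    have "((\<lambda>t. E 2 t / of_real t ^ 1 - (y t / of_real t) * y t ^ n * A' 2 t) \<longlongrightarrow> 0 - 0 * 0 ^ n * A' 2 0) (at 0)"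
      using m by (intro tendsto_diff small ym) auto
    moreover have "E 2 t / of_real t ^ 1 - (y t / of_real t) * y t ^ n * A' 2 t = z t / of_real t * g' 2 t" for t
      unfolding E by (simp add: n axis_def add_divide_distrib)
    moreover have "((\<lambda>t. z t / of_real t * g' 2 t) \<longlongrightarrow> w $ 4 * g' 2 0) (at 0)"
      by (intro tendsto_intros zdt g't)
    ultimately have "w $ 4 * g' 2 0 = 0"
      using tendsto_unique[OF trivial_limit_at] by fastforce
    then show ?thesis using g2 by (simp add: g'_def)
  qed
  have "((\<lambda>t. E 4 t / of_real t ^ 1 - (y t / of_real t) * y t ^ n * A' 4 t - z t / of_real t * g' 4 t)
      \<longlongrightarrow> 0 - 0 * 0 ^ n * A' 4 0 - 0 * g' 4 0) (at 0)"
    using m zdt w4 by (intro tendsto_diff tendsto_mult small ym g't) auto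
  moreover have "E 4 t / of_real t ^ 1 - (y t / of_real t) * y t ^ n * A' 4 t - z t / of_real t * g' 4 t =
      peval g (\<delta> t) / of_real t" for t
    unfolding E by (simp add: n axis_def add_divide_distrib)
  ultimately have "(\<Sum>i\<in>UNIV. g' i 0 * w $ i) = 0"
    using tendsto_unique[OF trivial_limit_at _ gdt] by fastforce
  then show "w $ 3 = 0" "w $ 4 = 0" "(\<Sum>i\<in>UNIV. peval (partial_deriv i g) (\<delta> 0) * w $ i) = 0"
    using w3 w4 by (simp_all add: g'_def)
qed

subsection \<open>Polynomials near a line\<close>

lemma peval_monomial_division:
  assumes "\<And>k. k \<in> K \<Longrightarrow> n \<le> Poly_Mapping.lookup k i"
  shows "peval (\<Sum>k\<in>K. Poly_Mapping.single k (c k)) x =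
    x $ i ^ n * peval (\<Sum>k\<in>K. Poly_Mapping.single (k - Poly_Mapping.single i n) (c k)) x"
proof -
  have "peval (Poly_Mapping.single k (c k)) x = x $ i ^ n * peval (Poly_Mapping.single (k - Poly_Mapping.single i n) (c k)) x"
    if "k \<in> K" for k
  proof -
    have "k = (k - Poly_Mapping.single i n) + Poly_Mapping.single i n"
      by (rule poly_mapping_eqI) (use assms[OF that] in \<open>auto simp: lookup_add lookup_minus lookup_single when_def\<close>)
    then have "Poly_Mapping.single k (c k) =
        Poly_Mapping.single (k - Poly_Mapping.single i n) (c k) * Poly_Mapping.single (Poly_Mapping.single i n) 1"
      by (simp add: mult_single)
    then have "peval (Poly_Mapping.single k (c k)) x =
        peval (Poly_Mapping.single (k - Poly_Mapping.single i n) (c k)) x * peval (Poly_Mapping.single (Poly_Mapping.single i n) 1) x"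
      by (simp only: peval_mult)
    then show ?thesis by (simp add: mult.commute)
  qed
  then show ?thesis unfolding peval_sum sum_distrib_left by (rule sum.cong[OF refl])
qed

text \<open>\<open>g\<close> collects the monomials divisible by the fourth variable; from the
  others the power \<open>m\<close> of the third variable is split off. As \<open>m\<close> is the
  least exponent, attained at \<open>k0\<close>, the quotient \<open>A\<close> contains a monomial
  in the first two variables only, so it cannot vanish on the whole line.\<close>

lemma decomposition_along_line:
  fixes G :: "4 cpoly"
  assumes G: "homogeneous d G"
    and le: "\<And>k. k \<in> Poly_Mapping.keys G \<Longrightarrow> Poly_Mapping.lookup k 4 = 0 \<Longrightarrow> m \<le> Poly_Mapping.lookup k 3"
    and k0: "k0 \<in> Poly_Mapping.keys G" "Poly_Mapping.lookup k0 4 = 0" "Poly_Mapping.lookup k0 3 = m"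
  obtains A g where "homogeneous (d - m) A" "homogeneous (d - 1) g"
    "\<And>x. peval G x = (x $ 3) ^ m * peval A x + x $ 4 * peval g x"
    "\<exists>x. x $ 3 = 0 \<and> x $ 4 = 0 \<and> peval A x \<noteq> 0"
proof -
  let ?l = Poly_Mapping.lookup
  define K0 where "K0 = {k \<in> Poly_Mapping.keys G. ?l k 4 = 0}"
  define K1 where "K1 = {k \<in> Poly_Mapping.keys G. ?l k 4 \<noteq> 0}"
  define A where "A = (\<Sum>k\<in>K0. Poly_Mapping.single (k - Poly_Mapping.single 3 m) (?l G k))"
  define g where "g = (\<Sum>k\<in>K1. Poly_Mapping.single (k - Poly_Mapping.single 4 1) (?l G k))"
  have deg: "(\<Sum>i\<in>UNIV. ?l k i) = d" if "k \<in> Poly_Mapping.keys G" for k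
    using G that by (simp add: homogeneous_def)
  have hA: "homogeneous (d - m) A"
    unfolding A_def
  proof (intro homogeneous_sum homogeneous_single)
    fix k assume "k \<in> K0"
    then show "(\<Sum>i\<in>UNIV. ?l (k - Poly_Mapping.single 3 m) i) = d - m"
      using sum_lookup_minus_single[of m k 3] le deg by (auto simp: K0_def)
  qed
  have hg: "homogeneous (d - 1) g"
    unfolding g_def
  proof (intro homogeneous_sum homogeneous_single)
    fix k assume "k \<in> K1"
    then show "(\<Sum>i\<in>UNIV. ?l (k - Poly_Mapping.single 4 1) i) = d - 1"
      using sum_lookup_minus_single[of 1 k 4] deg by (auto simp: K1_def)
  qed
  have keys: "Poly_Mapping.keys G = K0 \<union> K1" by (auto simp: K0_def K1_def)
  have "G = (\<Sum>k\<in>K0 \<union> K1. Poly_Mapping.single k (?l G k))"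
    using poly_mapping_sum_single[of G] unfolding keys .
  also have "\<dots> = (\<Sum>k\<in>K0. Poly_Mapping.single k (?l G k)) + (\<Sum>k\<in>K1. Poly_Mapping.single k (?l G k))"
    by (rule sum.union_disjoint) (auto simp: K0_def K1_def)
  finally have "peval G x = peval (\<Sum>k\<in>K0. Poly_Mapping.single k (?l G k)) x + peval (\<Sum>k\<in>K1. Poly_Mapping.single k (?l G k)) x" for x
    unfolding peval_add[symmetric] by (rule arg_cong)
  moreover have "peval (\<Sum>k\<in>K0. Poly_Mapping.single k (?l G k)) x = x $ 3 ^ m * peval A x" for x
    unfolding A_def by (rule peval_monomial_division) (use le in \<open>auto simp: K0_def\<close>)
  moreover have "peval (\<Sum>k\<in>K1. Poly_Mapping.single k (?l G k)) x = x $ 4 ^ 1 * peval g x" for x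
    unfolding g_def by (rule peval_monomial_division) (auto simp: K1_def)
  ultimately have dec: "peval G x = (x $ 3) ^ m * peval A x + x $ 4 * peval g x" for x
    by simp
  have "\<exists>x. x $ 3 = 0 \<and> x $ 4 = 0 \<and> peval A x \<noteq> 0"
  proof (rule ccontr)
    assume neg: "\<not> (\<exists>x. x $ 3 = 0 \<and> x $ 4 = 0 \<and> peval A x \<noteq> 0)"
    \<comment> \<open>Lowering the exponent by \<open>m\<close> is injective on \<open>K0\<close>,
      where no truncation occurs, so the coefficient of \<open>k0\<close> is not merged with another
      one.\<close>
    have "k = k0" if "k \<in> K0" "k - Poly_Mapping.single 3 m = k0 - Poly_Mapping.single 3 m" for k
    proof (rule poly_mapping_eqI)
      fix i
      have "?l (k - Poly_Mapping.single 3 m) i = ?l (k0 - Poly_Mapping.single 3 m) i"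
        using that by simp
      moreover have "m \<le> ?l k 3" using that le by (simp add: K0_def)
      ultimately show "?l k i = ?l k0 i"
        using k0(3) by (cases "i = 3") (auto simp: lookup_minus lookup_single)
    qed
    then have "?l A (k0 - Poly_Mapping.single 3 m) = (\<Sum>k\<in>K0. if k = k0 then ?l G k else 0)"
      unfolding A_def lookup_sum lookup_single when_def by (intro sum.cong) auto
    also have "\<dots> = ?l G k0" using k0 by (simp add: K0_def)
    finally have "k0 - Poly_Mapping.single 3 m \<in> Poly_Mapping.keys A"
      using k0(1) by (simp add: in_keys_iff)
    then have "\<exists>i\<in>{3, 4}. ?l (k0 - Poly_Mapping.single 3 m) i \<noteq> 0"
      by (rule key_of_vanishing[rotated]) (use neg in auto)
    then show False using k0 by (auto simp: lookup_minus)
  qed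
  then show thesis using that hA hg dec by blast
qed

section \<open>Restriction of forms to a line\<close>

lemma degree_prod_power_le:
  "(\<And>i. i \<in> I \<Longrightarrow> degree (f i) \<le> 1) \<Longrightarrow> degree (\<Prod>i\<in>I. f i ^ e i :: 'a::comm_semiring_1 poly) \<le> (\<Sum>i\<in>I. e i)"
proof (induction I rule: infinite_finite_induct)
  case (insert i I)
  have "degree (f i ^ e i) \<le> e i"
    using degree_power_le[of "f i" "e i"] insert.prems[of i] by (auto intro: order.trans)
  then show ?case
    using insert degree_mult_le[of "f i ^ e i" "\<Prod>i\<in>I. f i ^ e i"] by (auto intro: order.trans add_mono)
qed auto

lemma peval_on_affine_line:
  assumes "homogeneous n G"
  obtains q where "degree q \<le> n" "\<And>\<tau>. poly q \<tau> = peval G (a + \<tau> *s b)"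
proof
  let ?q = "\<Sum>k\<in>Poly_Mapping.keys G. smult (Poly_Mapping.lookup G k) (\<Prod>i\<in>UNIV. [:a $ i, b $ i:] ^ Poly_Mapping.lookup k i)"
  show "degree ?q \<le> n"
  proof (rule degree_sum_le)
    fix k assume k: "k \<in> Poly_Mapping.keys G"
    have "degree (\<Prod>i\<in>UNIV. [:a $ i, b $ i:] ^ Poly_Mapping.lookup k i) \<le> (\<Sum>i\<in>UNIV. Poly_Mapping.lookup k i)"
      by (rule degree_prod_power_le) simp
    also have "\<dots> = n" using assms k by (simp add: homogeneous_def)
    finally show "degree (smult (Poly_Mapping.lookup G k) (\<Prod>i\<in>UNIV. [:a $ i, b $ i:] ^ Poly_Mapping.lookup k i)) \<le> n"
      by (rule order.trans[OF degree_smult_le])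
  qed simp
  show "poly ?q \<tau> = peval G (a + \<tau> *s b)" for \<tau>
    by (simp add: poly_sum poly_prod peval_def)
qed

text \<open>The line through \<open>a\<close> and \<open>b\<close> is the closure of its affine part.\<close>

lemma vanish_on_line:
  fixes f :: "complex ^ 'n::finite \<Rightarrow> complex"
  assumes cont: "continuous_on UNIV f" and scale: "\<And>c x. f (c *s x) = c ^ n * f x"
    and zero: "\<And>\<tau>. f (a + \<tau> *s b) = 0"
  shows "f (s *s a + t *s b) = 0"
proof -
  have nz: "f (s *s a + t *s b) = 0" if "s \<noteq> 0" for s
  proof -
    have "s *s a + t *s b = s *s (a + (t / s) *s b)"
      using that by (simp add: vec_eq_iff algebra_simps)
    then show ?thesis by (simp only: scale zero) simp
  qed
  show ?thesis
  proof (cases "s = 0")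
    case True
    have "((\<lambda>s. s *s a + t *s b) \<longlongrightarrow> 0 *s a + t *s b) (at 0)"
      by (intro vec_tendstoI) (auto intro!: tendsto_eq_intros)
    moreover have "isCont f x" for x
      using cont continuous_on_eq_continuous_at[OF open_UNIV] by blast
    ultimately have "((\<lambda>s. f (s *s a + t *s b)) \<longlongrightarrow> f (0 *s a + t *s b)) (at 0)"
      by (rule isCont_tendsto_compose[rotated])
    moreover have "((\<lambda>s. f (s *s a + t *s b)) \<longlongrightarrow> 0) (at 0)"
      by (rule tendsto_eventually) (auto simp: eventually_at_filter nz)
    ultimately show ?thesis
      using tendsto_unique[OF trivial_limit_at] True by blast
  qed (rule nz)
qed

section \<open>Vanishing on hyperplanes and divisibility by linear forms\<close>

definition linear_form :: "complex ^ 'n \<Rightarrow> 'n::finite cpoly" where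
  "linear_form c = (\<Sum>i\<in>UNIV. Poly_Mapping.single (Poly_Mapping.single i 1) (c $ i))"

lemma peval_linear_form [simp]: "peval (linear_form c) x = (\<Sum>i\<in>UNIV. c $ i * x $ i)"
  by (simp add: linear_form_def)

lemma dvd_mult_diff:
  fixes l :: "'a::comm_ring_1"
  assumes "l dvd a - a'" "l dvd b - b'"
  shows "l dvd a * b - a' * b'"
proof -
  have "a * b - a' * b' = (a - a') * b + a' * (b - b')" by (simp add: algebra_simps)
  then show ?thesis using assms by simp
qed

lemma dvd_power_diff: "(l :: 'a::comm_ring_1) dvd a - a' \<Longrightarrow> l dvd a ^ n - a' ^ n"
  by (induction n) (auto intro: dvd_mult_diff)

lemma dvd_prod_diff:
  "(\<And>i. i \<in> I \<Longrightarrow> (l :: 'a::comm_ring_1) dvd f i - f' i) \<Longrightarrow> l dvd (\<Prod>i\<in>I. f i) - (\<Prod>i\<in>I. f' i)"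
  by (induction I rule: infinite_finite_induct) (auto intro: dvd_mult_diff)

text \<open>Congruence modulo \<open>l\<close> is compatible with sums and products, so substituting
  congruent linear forms gives congruent polynomials.\<close>

lemma dvd_linear_subst_diff:
  assumes "\<And>i. l dvd linear_form (A $ i) - linear_form (B $ i)"
  shows "l dvd linear_subst A F - linear_subst B F"
  unfolding linear_subst_def sum_subtractf[symmetric] right_diff_distrib[symmetric]
  by (intro dvd_sum dvd_mult dvd_prod_diff dvd_power_diff assms[unfolded linear_form_def])

text \<open>\<open>M\<close> is the projection onto the hyperplane along the \<open>k\<close>-th
  axis. \<open>F\<close> composed with \<open>M\<close> vanishes, and \<open>M\<close> is congruent
  to the identity modulo the linear form, hence so is \<open>F\<close> to 0.\<close>

lemma linear_form_dvd:
  fixes F :: "'n::finite cpoly"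
  assumes k: "c $ k \<noteq> 0" and zero: "\<And>x. (\<Sum>i\<in>UNIV. c $ i * x $ i) = 0 \<Longrightarrow> peval F x = 0"
  shows "linear_form c dvd F"
proof -
  define M :: "complex ^ 'n ^ 'n" where
    "M = (\<chi> i j. (if i = j then 1 else 0) - (if i = k then c $ j / c $ k else 0))"
  have My: "(M *v y) $ i = y $ i - (if i = k then (\<Sum>j\<in>UNIV. c $ j * y $ j) / c $ k else 0)" for y i
  proof -
    have "M $ i $ j * y $ j = (if i = j then y $ j else 0) - (if i = k then c $ j * y $ j / c $ k else 0)" for j
      by (simp add: M_def algebra_simps)
    then show ?thesis
      by (cases "i = k") (simp_all add: matrix_vector_mult_def sum_subtractf sum_divide_distrib)
  qed
  have "peval (linear_subst M F) y = 0" for y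
  proof -
    have "(\<Sum>i\<in>UNIV. c $ i * (M *v y) $ i) = (\<Sum>j\<in>UNIV. c $ j * y $ j) - (\<Sum>i\<in>UNIV. if i = k then c $ i * ((\<Sum>j\<in>UNIV. c $ j * y $ j) / c $ k) else 0)"
      unfolding My right_diff_distrib sum_subtractf by (simp add: if_distrib cong: if_cong)
    also have "\<dots> = 0" using k by simp
    finally show ?thesis by (simp add: zero)
  qed
  then have "linear_subst M F = 0" by (rule peval_eq_0_imp)
  moreover have "linear_subst (mat 1) F = F" by (rule peval_inject) simp
  moreover have "linear_form c dvd linear_subst (mat 1) F - linear_subst M F"
  proof (rule dvd_linear_subst_diff)
    fix i
    have "linear_form (mat 1 $ i) - linear_form (M $ i) =
        linear_form c * Poly_Mapping.single 0 (if i = k then 1 / c $ k else 0)"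
    proof (rule peval_inject)
      fix y :: "complex ^ 'n"
      have "(\<Sum>j\<in>UNIV. mat 1 $ i $ j * y $ j) = (mat 1 *v y) $ i" "(\<Sum>j\<in>UNIV. M $ i $ j * y $ j) = (M *v y) $ i"
        by (simp_all add: matrix_vector_mult_def)
      then show "peval (linear_form (mat 1 $ i) - linear_form (M $ i)) y =
          peval (linear_form c * Poly_Mapping.single 0 (if i = k then 1 / c $ k else 0)) y"
        by (simp add: My)
    qed
    then show "linear_form c dvd linear_form (mat 1 $ i) - linear_form (M $ i)" by simp
  qed
  ultimately show ?thesis by simp
qed

text \<open>Otherwise the linear form divides \<open>F\<close>. It is not a unit because it vanishes
  at the origin, and for \<open>d \<ge> 2\<close> the cofactor vanishes at the origin as well, so
  \<open>F\<close> would be reducible.\<close>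

lemma irreducible_nonzero_on_hyperplane:
  fixes F :: "'n::finite cpoly"
  assumes F: "homogeneous d F" "irreducible F" and d: "d \<ge> 2" and k: "c $ k \<noteq> 0"
  obtains x where "(\<Sum>i\<in>UNIV. c $ i * x $ i) = 0" "peval F x \<noteq> 0"
proof (rule ccontr)
  assume "\<not> thesis"
  then have "linear_form c dvd F"
    using that by (intro linear_form_dvd[OF k]) blast
  then obtain H where H: "F = linear_form c * H" ..
  with F(2) consider "linear_form c dvd 1" | "H dvd 1"
    using irreducibleD by blast
  then show False
  proof cases
    case 1
    then obtain K where "1 = linear_form c * K" ..
    then have "peval 1 0 = peval (linear_form c * K) 0" by simp
    then show False by (simp del: peval_0)
  next
    case 2
    then obtain K where K: "1 = H * K" ..
    define e where "e = axis k (1 / c $ k)"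
    have ce: "(\<Sum>i\<in>UNIV. c $ i * e $ i) = 1"
      using k by (simp add: e_def axis_def if_distrib cong: if_cong)
    \<comment> \<open>The cofactor \<open>H\<close> is not known to be homogeneous, but on the line
      through \<open>e\<close>, where the linear form takes the value \<open>s\<close>, it behaves
      like a form of degree \<open>d - 1\<close>; continuity then gives its value at 0.\<close>
    have "peval H (s *s e) = s ^ (d - 1) * peval F e" if "s \<noteq> 0" for s
    proof -
      have "s ^ d * peval F e = peval F (s *s e)" by (simp add: peval_scale[OF F(1)])
      also have "\<dots> = s * (\<Sum>i\<in>UNIV. c $ i * e $ i) * peval H (s *s e)"
        unfolding H by (simp add: sum_distrib_left mult_ac)
      finally have "s * (s ^ (d - 1) * peval F e) = s * peval H (s *s e)"
        using d by (simp add: ce power_eq_if[of s d] mult.assoc)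
      then show ?thesis using that by simp
    qed
    then have ev: "\<forall>\<^sub>F s in at 0. peval H (s *s e) = s ^ (d - 1) * peval F e"
      by (auto simp: eventually_at_filter)
    have "((\<lambda>s. s ^ (d - 1) * peval F e) \<longlongrightarrow> 0) (at 0)"
      using d by (auto intro!: tendsto_eq_intros simp: power_0_left)
    then have "((\<lambda>s. peval H (s *s e)) \<longlongrightarrow> 0) (at 0)"
      using tendsto_cong[OF ev] by simp
    moreover have "((\<lambda>s. peval H (s *s e)) \<longlongrightarrow> peval H (0 *s e)) (at 0)"
      by (intro tendsto_peval vec_tendstoI) (auto intro!: tendsto_eq_intros)
    ultimately have "peval H 0 = 0"
      using tendsto_unique[OF trivial_limit_at] by fastforce
    moreover have "peval H 0 * peval K 0 = 1"
      unfolding peval_mult[symmetric] K[symmetric] by (rule peval_1)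
    ultimately show False by simp
  qed
qed

subsection \<open>Lines on the surface\<close>

text \<open>With \<open>c\<close> the coefficient of \<open>q\<close> in degree
  \<open>card T\<close>, possibly 0, the difference has no term of that degree, yet it vanishes on
  all of \<open>T\<close>.\<close>

lemma poly_eq_smult_prod_roots:
  fixes q :: "complex poly"
  assumes "finite T" "degree q \<le> card T" "\<And>\<sigma>. \<sigma> \<in> T \<Longrightarrow> poly q \<sigma> = 0"
  obtains c where "\<And>\<tau>. poly q \<tau> = c * (\<Prod>\<sigma>\<in>T. \<tau> - \<sigma>)"
proof
  define p where "p = (\<Prod>\<sigma>\<in>T. [:-\<sigma>, 1:])"
  define r where "r = q - smult (coeff q (card T)) p"
  have deg_p: "degree p = card T"
    unfolding p_def by (subst degree_prod_sum_eq) auto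
  have "lead_coeff p = 1" by (simp add: p_def lead_coeff_prod)
  then have "coeff r (card T) = 0" by (simp add: r_def deg_p)
  moreover have "degree r \<le> card T"
    unfolding r_def using assms(2) deg_p by (intro degree_diff_le order.trans[OF degree_smult_le]) auto
  moreover have "card T \<le> degree r" if "r \<noteq> 0"
  proof -
    have "T \<subseteq> {x. poly r x = 0}"
      using assms by (auto simp: r_def p_def poly_prod)
    then have "card T \<le> card {x. poly r x = 0}"
      by (rule card_mono[OF poly_roots_finite[OF that]])
    also have "\<dots> \<le> degree r" by (rule card_poly_roots_bound[OF that])
    finally show ?thesis .
  qed
  ultimately have "r = 0"
    by (metis le_antisym leading_coeff_0_iff)
  then have "q = smult (coeff q (card T)) p" by (simp add: r_def)
  then show "poly q \<tau> = coeff q (card T) * (\<Prod>\<sigma>\<in>T. \<tau> - \<sigma>)" for \<tau>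
    by (metis (no_types, lifting) p_def poly_smult poly_prod prod.cong poly_pCons poly_0 mult_zero_right add.right_neutral mult.right_neutral add_uminus_conv_diff add.commute)
qed

text \<open>The zeros are simple because \<open>T\<close> is a set; the derivative is the product of
  the remaining factors.\<close>

lemma DERIV_prod_roots:
  assumes "finite T" "\<sigma> \<in> T"
  obtains D where "D \<noteq> 0" "((\<lambda>\<tau>. \<Prod>\<rho>\<in>T. \<tau> - \<rho> :: complex) has_field_derivative D) (at \<sigma>)"
proof -
  define r where "r = (\<Prod>\<rho>\<in>T - {\<sigma>}. [:-\<rho>, 1:])"
  have r: "poly r \<tau> = (\<Prod>\<rho>\<in>T - {\<sigma>}. \<tau> - \<rho>)" for \<tau>
    by (simp add: r_def poly_prod)
  have "poly r \<sigma> \<noteq> 0" using assms by (simp add: r)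
  moreover have "((\<lambda>\<tau>. (\<tau> - \<sigma>) * poly r \<tau>) has_field_derivative poly r \<sigma>) (at \<sigma>)"
    by (auto intro!: derivative_eq_intros)
  then have "((\<lambda>\<tau>. \<Prod>\<rho>\<in>T. \<tau> - \<rho>) has_field_derivative poly r \<sigma>) (at \<sigma>)"
    using assms by (simp add: r prod.remove[of T \<sigma>])
  ultimately show thesis using that by blast
qed

section \<open>Coordinates on a projective line\<close>

lemma span_pair: "x \<in> vec.span {a, b} \<longleftrightarrow> (\<exists>s t. x = s *s a + t *s b)"
  unfolding vec.span_breakdown_eq[of x a] vec.span_singleton by (auto simp: image_iff diff_eq_eq add.commute)

lemma span_singleton_cong:
  assumes "c \<noteq> (0::'a::field)"
  shows "vec.span {c *s x} = vec.span {x}"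
proof -
  have "inverse c *s (c *s x) \<in> vec.span {c *s x}"
    by (intro vec.span_scale vec.span_base) simp
  then have "x \<in> vec.span {c *s x}" using assms by simp
  moreover have "c *s x \<in> vec.span {x}"
    by (intro vec.span_scale vec.span_base) simp
  ultimately show ?thesis by (simp add: vec.span_eq)
qed

lemma line_point_inject:
  fixes a b :: "complex ^ 'n"
  assumes ind: "\<And>s t. s *s a + t *s b = 0 \<Longrightarrow> s = 0 \<and> t = 0"
    and "vec.span {a + \<tau> *s b} = vec.span {a + \<sigma> *s b}"
  shows "\<tau> = \<sigma>"
proof -
  have "a + \<tau> *s b \<in> vec.span {a + \<sigma> *s b}"
    using assms(2) vec.span_base by blast
  then obtain c where "a + \<tau> *s b = c *s (a + \<sigma> *s b)"
    unfolding vec.span_singleton by auto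
  then have "(1 - c) *s a + (\<tau> - c * \<sigma>) *s b = 0"
    by (simp add: vec_eq_iff algebra_simps)
  from ind[OF this] show ?thesis by auto
qed

text \<open>The point at infinity \<open>b\<close> is moved away from the finite set
  \<open>S\<close>, so that every point of \<open>S\<close> has an affine parameter and univariate
  polynomials see all of them.\<close>

lemma proj_line_coordinates:
  fixes \<Lambda> :: "(complex ^ 'n) set set"
  assumes "proj_line \<Lambda>" "finite S" "S \<subseteq> \<Lambda>"
  obtains a b where
    "\<And>s t. s *s a + t *s b = 0 \<Longrightarrow> s = 0 \<and> t = 0"
    "\<Lambda> = {p \<in> proj_space. p \<subseteq> vec.span {a, b}}"
    "\<And>p. p \<in> S \<Longrightarrow> \<exists>\<tau>. p = vec.span {a + \<tau> *s b}"
proof -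
  obtain L where L: "vec.subspace L" "vec.dim L = 2" "\<Lambda> = {p \<in> proj_space. p \<subseteq> L}"
    using assms(1) unfolding proj_line_def by blast
  obtain E where E: "E \<subseteq> L" "vec.independent E" "L \<subseteq> vec.span E" "card E = vec.dim L"
    using vec.basis_exists by blast
  then obtain u v where uv: "E = {u, v}" "u \<noteq> v"
    using L(2) by (metis card_2_iff)
  have LE: "L = vec.span {u, v}"
    using E L(1) uv vec.span_minimal by blast
  have ind: "s = 0 \<and> t = 0" if "s *s u + t *s v = 0" for s t
  proof -
    have "u \<notin> vec.span {v}" "v \<noteq> 0"
      using E(2) uv by (auto simp: vec.independent_insert vec.dependent_single)
    have "s = 0"
    proof (rule ccontr)
      assume "s \<noteq> 0"
      then have "u = (- t / s) *s v"
        using that by (simp add: vec_eq_iff field_simps add_eq_0_iff)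
      moreover have "(- t / s) *s v \<in> vec.span {v}"
        by (intro vec.span_scale vec.span_base) simp
      ultimately show False using \<open>u \<notin> vec.span {v}\<close> by simp
    qed
    then show ?thesis using that \<open>v \<noteq> 0\<close> by simp
  qed
  \<comment> \<open>The line has infinitely many points, so one of them lies outside
    \<open>S\<close> and can serve as \<open>b\<close>; \<open>v\<close> takes the role of
    \<open>a\<close>.\<close>
  have "inj (\<lambda>\<tau>. vec.span {u + \<tau> *s v})"
    by (rule injI) (rule line_point_inject[OF ind])
  then have "infinite (range (\<lambda>\<tau>. vec.span {u + \<tau> *s v}))"
    using finite_imageD infinite_UNIV_char_0 by blast
  then have "\<not> range (\<lambda>\<tau>. vec.span {u + \<tau> *s v}) \<subseteq> S"
    using assms(2) finite_subset by blast
  then obtain \<tau> where \<tau>: "vec.span {u + \<tau> *s v} \<notin> S"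
    by blast
  define b where "b = u + \<tau> *s v"
  have ind': "s = 0 \<and> t = 0" if "s *s v + t *s b = 0" for s t
  proof -
    have "t *s u + (s + t * \<tau>) *s v = 0"
      using that by (simp add: b_def vec_eq_iff algebra_simps)
    from ind[OF this] show ?thesis by auto
  qed
  have Lb: "L = vec.span {v, b}"
  proof -
    have "\<exists>s' t'. s *s u + t *s v = s' *s v + t' *s b" for s t
      by (rule exI[of _ "t - s * \<tau>"], rule exI[of _ s]) (simp add: b_def vec_eq_iff algebra_simps)
    moreover have "\<exists>s' t'. s *s v + t *s b = s' *s u + t' *s v" for s t
      by (rule exI[of _ t], rule exI[of _ "s + t * \<tau>"]) (simp add: b_def vec_eq_iff algebra_simps)
    ultimately show ?thesis unfolding LE set_eq_iff span_pair by metis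
  qed
  have "\<exists>\<tau>. p = vec.span {v + \<tau> *s b}" if p: "p \<in> S" for p
  proof -
    obtain x where x: "p = vec.span {x}" "x \<noteq> 0"
      using p assms(3) L(3) by (auto simp: proj_space_def)
    have "x \<in> L" using p assms(3) L(3) x vec.span_base by blast
    then obtain s t where st: "x = s *s v + t *s b"
      unfolding Lb span_pair by blast
    have "s \<noteq> 0"
    proof
      assume "s = 0"
      then have "p = vec.span {t *s b}" "t \<noteq> 0" using st x by auto
      then have "p = vec.span {b}" using span_singleton_cong by metis
      then show False using p \<tau> by (simp add: b_def)
    qed
    then have "x = s *s (v + (t / s) *s b)"
      by (simp add: st vec_eq_iff algebra_simps)
    then show ?thesis using x(1) span_singleton_cong[OF \<open>s \<noteq> 0\<close>] by metis
  qed
  then show thesis using that ind' L(3) Lb by blast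
qed

lemma zariski_closed_sing_locus:
  assumes "homogeneous d F"
  shows "zariski_closed (sing_locus F)"
  unfolding zariski_closed_def
proof (intro exI conjI)
  let ?G = "insert F (range (\<lambda>i. partial_deriv i F))"
  show "\<forall>G\<in>?G. \<exists>e. homogeneous e G"
    using assms homogeneous_partial_deriv by blast
  show "sing_locus F = proj_space \<inter> (\<Inter>G\<in>?G. zero_locus G)"
    by (auto simp: sing_locus_def zero_locus_def)
qed

lemma DERIV_direction_eq_0:
  assumes "\<And>s. peval F (x + s *s v) = 0"
  shows "(\<Sum>i\<in>UNIV. peval (partial_deriv i F) x * v $ i) = 0"
proof -
  have "((\<lambda>s. peval F (x + s *s v)) has_field_derivative (\<Sum>i\<in>UNIV. (\<chi> i. peval (partial_deriv i F) x) $ i * v $ i)) (at 0)"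
    by (rule DERIV_line) (use has_derivative_peval[of F x] in simp)
  then have "((\<lambda>s. 0) has_field_derivative (\<Sum>i\<in>UNIV. peval (partial_deriv i F) x * v $ i)) (at 0)"
    by (simp add: assms)
  then show ?thesis using DERIV_unique DERIV_const by blast
qed

lemma sum_axis_mult: "(\<Sum>i\<in>UNIV. f i * axis j c $ i) = f j * (c :: 'a::semiring_1)"
  by (simp add: axis_def if_distrib cong: if_cong)

text \<open>Scaling by 0, where \<open>0 ^ 0 = 1\<close>.\<close>

lemma peval_homogeneous_0:
  assumes "homogeneous 0 A"
  shows "peval A x = peval A 0"
  using peval_scale[OF assms, of 0 x] by simp

lemma peval_eq_0_if_keys:
  assumes "\<And>k. k \<in> Poly_Mapping.keys G \<Longrightarrow> Poly_Mapping.lookup k i \<noteq> 0" "x $ i = 0"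
  shows "peval G x = 0"
  unfolding peval_def
proof (rule sum.neutral, rule ballI)
  fix k assume "k \<in> Poly_Mapping.keys G"
  then have "x $ i ^ Poly_Mapping.lookup k i = 0" using assms by simp
  then have "(\<Prod>i\<in>UNIV. x $ i ^ Poly_Mapping.lookup k i) = 0"
    by (metis UNIV_I finite_class.finite_UNIV prod_zero)
  then show "Poly_Mapping.lookup G k * (\<Prod>i\<in>UNIV. x $ i ^ Poly_Mapping.lookup k i) = 0" by simp
qed

section \<open>The tangent plane along the line\<close>

locale surface_line =
  fixes F :: "4 cpoly" and d :: nat and a b :: "complex ^ 4" and T :: "complex set"
  assumes homogeneous: "homogeneous d F" and irreducible: "irreducible F" and d: "d \<ge> 3"
    and independent: "\<And>s t. s *s a + t *s b = 0 \<Longrightarrow> s = 0 \<and> t = 0"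
    and on_surface: "\<And>s t. peval F (s *s a + t *s b) = 0"
    and T: "finite T" "card T = d - 1"
    and sing: "\<And>\<sigma>. \<sigma> \<in> T \<Longrightarrow> A_singularity (d - 1) F (vec.span {a + \<sigma> *s b})"
    and not_sing: "\<exists>s t i. peval (partial_deriv i F) (s *s a + t *s b) \<noteq> 0"
begin

text \<open>Already contained in the curve estimate: a neighbourhood of 0 includes
  \<open>t = 0\<close>, where the bound is \<open>C * 0 ^ (d - 1)\<close>, that is 0.\<close>

lemma gradient_at_singularity:
  assumes "\<sigma> \<in> T"
  shows "peval (partial_deriv i F) (a + \<sigma> *s b) = 0"
proof -
  have "d \<ge> 1" using d by simp
  obtain \<gamma> v where \<gamma>: "\<gamma> 0 \<in> vec.span {a + \<sigma> *s b}" "\<gamma> 0 \<noteq> 0"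
    "(\<gamma> has_vector_derivative v) (at 0)" "v \<notin> vec.span {\<gamma> 0}"
    "\<forall>i. \<exists>C. \<forall>\<^sub>F t::real in nhds 0. norm (peval (partial_deriv i F) (\<gamma> t)) \<le> C * \<bar>t\<bar> ^ (d - 1)"
    by (rule A_singularity_curve[OF homogeneous \<open>d \<ge> 1\<close> sing[OF assms]]) (rule that)
  obtain C where "\<forall>\<^sub>F t::real in nhds 0. norm (peval (partial_deriv i F) (\<gamma> t)) \<le> C * \<bar>t\<bar> ^ (d - 1)"
    using \<gamma>(5) by blast
  from eventually_nhds_x_imp_x[OF this] have "peval (partial_deriv i F) (\<gamma> 0) = 0"
    using d by (simp add: power_0_left)
  moreover obtain c where c: "\<gamma> 0 = c *s (a + \<sigma> *s b)"
    using \<gamma>(1) unfolding vec.span_singleton by auto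
  ultimately have "c ^ (d - 1) * peval (partial_deriv i F) (a + \<sigma> *s b) = 0"
    by (simp only: peval_scale[OF homogeneous_partial_deriv[OF homogeneous]])
  moreover have "c \<noteq> 0" using c \<gamma>(2) by auto
  ultimately show ?thesis by simp
qed

text \<open>The coefficients of the tangent plane: each partial derivative has degree \<open>d - 1\<close> on the line and
  vanishes at the \<open>d - 1\<close> singular points, so the tangent plane is constant along the line.\<close>

definition \<nu> :: "complex ^ 4" where
  "\<nu> = (SOME l. \<forall>i \<tau>. peval (partial_deriv i F) (a + \<tau> *s b) = l $ i * (\<Prod>\<sigma>\<in>T. \<tau> - \<sigma>))"

lemma gradient: "peval (partial_deriv i F) (a + \<tau> *s b) = \<nu> $ i * (\<Prod>\<sigma>\<in>T. \<tau> - \<sigma>)"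
proof -
  have "\<exists>c. \<forall>\<tau>. peval (partial_deriv i F) (a + \<tau> *s b) = c * (\<Prod>\<sigma>\<in>T. \<tau> - \<sigma>)" for i
  proof -
    obtain q where q: "degree q \<le> d - 1" "\<And>\<tau>. poly q \<tau> = peval (partial_deriv i F) (a + \<tau> *s b)"
      using peval_on_affine_line[OF homogeneous_partial_deriv[OF homogeneous]] by blast
    obtain c where "\<And>\<tau>. poly q \<tau> = c * (\<Prod>\<sigma>\<in>T. \<tau> - \<sigma>)"
      by (rule poly_eq_smult_prod_roots[OF T(1), of q]) (use q T gradient_at_singularity in auto)
    then show ?thesis unfolding q(2) by blast
  qed
  then obtain c where "\<And>i \<tau>. peval (partial_deriv i F) (a + \<tau> *s b) = c i * (\<Prod>\<sigma>\<in>T. \<tau> - \<sigma>)"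
    by metis
  then have "\<forall>i \<tau>. peval (partial_deriv i F) (a + \<tau> *s b) = (\<chi> i. c i) $ i * (\<Prod>\<sigma>\<in>T. \<tau> - \<sigma>)"
    by simp
  from someI[where P = "\<lambda>l. \<forall>i \<tau>. peval (partial_deriv i F) (a + \<tau> *s b) = l $ i * (\<Prod>\<sigma>\<in>T. \<tau> - \<sigma>)", OF this]
  show ?thesis unfolding \<nu>_def by blast
qed

text \<open>A form of \<open>gradient\<close> without the affine parameter, which therefore also
  covers the point \<open>b\<close> at infinity.\<close>

lemma gradient_proportional:
  "peval (partial_deriv i F) (s *s a + t *s b) * \<nu> $ j = peval (partial_deriv j F) (s *s a + t *s b) * \<nu> $ i"
proof -
  define f where "f x = peval (partial_deriv i F) x * \<nu> $ j - peval (partial_deriv j F) x * \<nu> $ i" for x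
  have "f (s *s a + t *s b) = 0"
  proof (rule vanish_on_line)
    show "continuous_on UNIV f"
      unfolding f_def by (intro continuous_intros)
    show "f (c *s x) = c ^ (d - 1) * f x" for c x
      by (simp add: f_def peval_scale[OF homogeneous_partial_deriv[OF homogeneous]] algebra_simps)
    show "f (a + \<tau> *s b) = 0" for \<tau>
      by (simp add: f_def gradient)
  qed
  then show ?thesis by (simp add: f_def)
qed

lemma \<nu>_nonzero: obtains j where "\<nu> $ j \<noteq> 0"
proof (rule ccontr)
  assume "\<not> thesis"
  then have 0: "\<nu> $ i = 0" for i using that by blast
  have "peval (partial_deriv i F) (s *s a + t *s b) = 0" for i s t
  proof (rule vanish_on_line)
    show "continuous_on UNIV (peval (partial_deriv i F))"
      by (rule continuous_on_peval_UNIV)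
    show "peval (partial_deriv i F) (c *s x) = c ^ (d - 1) * peval (partial_deriv i F) x" for c x
      by (rule peval_scale[OF homogeneous_partial_deriv[OF homogeneous]])
    show "peval (partial_deriv i F) (a + \<tau> *s b) = 0" for \<tau>
      by (simp add: gradient 0)
  qed
  then show False using not_sing by blast
qed

text \<open>\<open>F\<close> vanishes along the line, so its derivatives in the directions
  \<open>a\<close> and \<open>b\<close> vanish there; at a parameter outside \<open>T\<close> the
  common factor of the gradient can be cancelled.\<close>

lemma \<nu>_line: "(\<Sum>i\<in>UNIV. \<nu> $ i * a $ i) = 0" "(\<Sum>i\<in>UNIV. \<nu> $ i * b $ i) = 0"
proof -
  obtain \<tau> where \<tau>: "\<tau> \<notin> T" using T(1) ex_new_if_finite infinite_UNIV_char_0 by blast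
  have nz: "(\<Prod>\<sigma>\<in>T. \<tau> - \<sigma>) \<noteq> 0" using \<tau> T(1) by auto
  have "(\<Sum>i\<in>UNIV. peval (partial_deriv i F) (a + \<tau> *s b) * a $ i) = 0"
  proof (rule DERIV_direction_eq_0)
    fix s
    have "a + \<tau> *s b + s *s a = (1 + s) *s a + \<tau> *s b" by (simp add: vec_eq_iff algebra_simps)
    then show "peval F (a + \<tau> *s b + s *s a) = 0" by (simp only: on_surface)
  qed
  then have "(\<Prod>\<sigma>\<in>T. \<tau> - \<sigma>) * (\<Sum>i\<in>UNIV. \<nu> $ i * a $ i) = 0"
    unfolding gradient by (simp only: sum_distrib_left mult_ac)
  then show "(\<Sum>i\<in>UNIV. \<nu> $ i * a $ i) = 0" using nz by simp
  have "(\<Sum>i\<in>UNIV. peval (partial_deriv i F) (a + \<tau> *s b) * b $ i) = 0"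
  proof (rule DERIV_direction_eq_0)
    fix s
    have "a + \<tau> *s b + s *s b = 1 *s a + (\<tau> + s) *s b" by (simp add: vec_eq_iff algebra_simps)
    then show "peval F (a + \<tau> *s b + s *s b) = 0" by (simp only: on_surface)
  qed
  then have "(\<Prod>\<sigma>\<in>T. \<tau> - \<sigma>) * (\<Sum>i\<in>UNIV. \<nu> $ i * b $ i) = 0"
    unfolding gradient by (simp only: sum_distrib_left mult_ac)
  then show "(\<Sum>i\<in>UNIV. \<nu> $ i * b $ i) = 0" using nz by simp
qed

text \<open>\<open>a\<close> and \<open>b\<close> span the line, \<open>e\<close> completes them to
  a basis of the plane defined by \<open>\<nu>\<close>, and \<open>f\<close> is normalised so that
  the fourth coordinate is the value of the linear form \<open>\<nu>\<close> itself.\<close>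

lemma adapted_basis:
  obtains B B' :: "complex ^ 4 ^ 4" and e f where
    "B ** B' = mat 1" "B' ** B = mat 1"
    "\<And>y. B *v y = y $ 1 *s a + y $ 2 *s b + y $ 3 *s e + y $ 4 *s f"
    "\<And>y. (\<Sum>i\<in>UNIV. \<nu> $ i * (B *v y) $ i) = y $ 4"
proof -
  obtain j where j: "\<nu> $ j \<noteq> 0" by (rule \<nu>_nonzero)
  define l where "l x = (\<Sum>i\<in>UNIV. \<nu> $ i * x $ i)" for x :: "complex ^ 4"
  have l: "l (x + y) = l x + l y" "l (c *s x) = c * l x" "l (x - y) = l x - l y" for x y c
    by (simp_all add: l_def algebra_simps sum.distrib sum_subtractf sum_distrib_left)
  have lab: "l a = 0" "l b = 0" using \<nu>_line by (simp_all add: l_def)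
  define f :: "complex ^ 4" where "f = axis j (1 / \<nu> $ j)"
  have lf: "l f = 1" using j by (simp add: l_def f_def sum_axis_mult)
  \<comment> \<open>If the kernel of \<open>l\<close> were contained in the span of \<open>a\<close>
    and \<open>b\<close>, then \<open>a\<close>, \<open>b\<close>, \<open>f\<close> would span a
    space of dimension 4.\<close>
  have "\<exists>e. l e = 0 \<and> e \<notin> vec.span {a, b}"
  proof (rule ccontr)
    assume neg: "\<not> ?thesis"
    have "x \<in> vec.span {a, b, f}" for x
    proof -
      have "l (x - l x *s f) = 0" by (simp add: l lf)
      then have "x - l x *s f \<in> vec.span {a, b}" using neg by blast
      then have "x - l x *s f \<in> vec.span {a, b, f}"
        using vec.span_mono[of "{a, b}" "{a, b, f}"] by blast
      moreover have "l x *s f \<in> vec.span {a, b, f}"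
        by (intro vec.span_scale vec.span_base) simp
      ultimately show ?thesis using vec.span_add by fastforce
    qed
    then have "vec.dim (UNIV :: (complex ^ 4) set) \<le> card {a, b, f}"
      by (intro vec.dim_le_card) auto
    also have "\<dots> \<le> 3" by (simp add: card_insert_if)
    finally show False by (simp add: card_cart_basis)
  qed
  then obtain e where e: "l e = 0" "e \<notin> vec.span {a, b}" by blast
  define B :: "complex ^ 4 ^ 4" where
    "B = (\<chi> i k. if k = 1 then a $ i else if k = 2 then b $ i else if k = 3 then e $ i else f $ i)"
  have B: "B *v y = y $ 1 *s a + y $ 2 *s b + y $ 3 *s e + y $ 4 *s f" for y
    by (simp add: vec_eq_iff B_def matrix_vector_mult_def sum_4)
  have lB: "l (B *v y) = y $ 4" for y
    by (simp add: B l lab lf e)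
  have "y = 0" if "B *v y = 0" for y
  proof -
    have 4: "y $ 4 = 0" using lB[of y] that by (simp add: l_def)
    have 3: "y $ 3 = 0"
    proof (rule ccontr)
      assume nz: "y $ 3 \<noteq> 0"
      have "e = (- y $ 1 / y $ 3) *s a + (- y $ 2 / y $ 3) *s b"
        using that nz by (simp add: B 4 vec_eq_iff field_simps) (metis add.commute add_eq_0_iff)
      then show False using e(2) span_pair by blast
    qed
    then have "y $ 1 = 0 \<and> y $ 2 = 0"
      using that 4 by (intro independent) (simp add: B)
    then show ?thesis using 3 4 by (simp add: vec_eq_iff forall_4)
  qed
  then obtain B' where "B' ** B = mat 1"
    using matrix_left_invertible_ker[of B] by blast
  then have "B ** B' = mat 1" by (simp add: matrix_left_right_inverse)
  then show thesis using that \<open>B' ** B = mat 1\<close> B lB by (simp add: l_def)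
qed

text \<open>At a singular point with \<open>A\<close> nonzero,
  \<open>critical_curve_direction\<close> leaves only the radial direction for the velocity of the
  curve, and \<open>A_singularity_curve\<close> excludes it.\<close>

lemma no_intermediate_multiplicity:
  fixes B B' :: "complex ^ 4 ^ 4" and A g :: "4 cpoly"
  assumes B: "B ** B' = mat 1" "B' ** B = mat 1"
    "\<And>y. B *v y = y $ 1 *s a + y $ 2 *s b + y $ 3 *s e + y $ 4 *s f"
    "\<And>y. (\<Sum>i\<in>UNIV. \<nu> $ i * (B *v y) $ i) = y $ 4"
    and A: "homogeneous (d - m) A" and g: "homogeneous (d - 1) g"
    and dec: "\<And>x. peval (linear_subst B F) x = (x $ 3) ^ m * peval A x + x $ 4 * peval g x"
    and A_nz: "\<exists>x. x $ 3 = 0 \<and> x $ 4 = 0 \<and> peval A x \<noteq> 0"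
  shows "m \<ge> d"
proof (rule ccontr)
  assume "\<not> m \<ge> d"
  then have "m < d" by simp
  define G where "G = linear_subst B F"
  have line: "B *v y = y $ 1 *s a + y $ 2 *s b" if "y $ 3 = 0" "y $ 4 = 0" for y
    using that by (simp add: B(3))
  have G_line: "peval G y = 0" if "y $ 3 = 0" "y $ 4 = 0" for y
    unfolding G_def peval_linear_subst line[OF that] by (rule on_surface)
  have Bcol: "(\<Sum>i\<in>UNIV. \<nu> $ i * B $ i $ k) = axis k 1 $ 4" for k
    using B(4)[of "axis k 1"] by (simp add: matrix_vector_mult_def sum_axis_mult)
  \<comment> \<open>The third basis vector lies in the plane defined by \<open>\<nu>\<close>, and
    the gradient of \<open>F\<close> on the line is proportional to \<open>\<nu>\<close>.\<close>
  have G3: "peval (partial_deriv 3 G) y = 0" if "y $ 3 = 0" "y $ 4 = 0" for y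
  proof -
    obtain j where j: "\<nu> $ j \<noteq> 0" by (rule \<nu>_nonzero)
    have "\<nu> $ j * peval (partial_deriv 3 G) y = (\<Sum>i\<in>UNIV. B $ i $ 3 * (peval (partial_deriv i F) (B *v y) * \<nu> $ j))"
      unfolding G_def partial_deriv_linear_subst by (simp add: sum_distrib_left mult_ac)
    also have "\<dots> = peval (partial_deriv j F) (B *v y) * (\<Sum>i\<in>UNIV. \<nu> $ i * B $ i $ 3)"
      unfolding line[OF that] gradient_proportional[of _ _ _ j] by (simp add: sum_distrib_left mult_ac)
    also have "\<dots> = 0" unfolding Bcol by (simp add: axis_def)
    finally show ?thesis using j by simp
  qed
  define u where "u \<tau> = axis 1 1 + \<tau> *s (axis 2 1 :: complex ^ 4)" for \<tau>
  have u: "u \<tau> $ 1 = 1" "u \<tau> $ 2 = \<tau>" "u \<tau> $ 3 = 0" "u \<tau> $ 4 = 0" for \<tau>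
    by (simp_all add: u_def axis_def)
  have Bu: "B *v u \<tau> = a + \<tau> *s b" for \<tau>
    by (simp add: line u)
  have decG: "peval G x = (x $ 3) ^ m * peval A x + x $ 4 * peval g x" for x
    unfolding G_def by (rule dec)
  \<comment> \<open>On the line, \<open>m = 0\<close> would make \<open>G\<close> equal to
    \<open>A\<close>, and \<open>m = 1\<close> would make its third partial derivative equal to
    \<open>A\<close>.\<close>
  have m: "m \<ge> 2"
  proof -
    obtain x where x: "x $ 3 = 0" "x $ 4 = 0" "peval A x \<noteq> 0" using A_nz by blast
    have "m \<noteq> 0" using decG[of x] G_line[of x] x by auto
    moreover have "m \<noteq> 1"
      using partial_deriv_decomposition[OF decG, of 3 x] G3[of x] x by (auto simp: axis_def)
    ultimately show ?thesis by linarith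
  qed
  \<comment> \<open>Vanishing at all \<open>d - 1\<close> points would exceed the degree
    \<open>d - m \<le> d - 2\<close>, and \<open>A\<close> would vanish on the whole line.\<close>
  obtain \<sigma> where \<sigma>: "\<sigma> \<in> T" "peval A (u \<sigma>) \<noteq> 0"
  proof (rule ccontr)
    assume "\<not> thesis"
    then have root: "peval A (u \<sigma>) = 0" if "\<sigma> \<in> T" for \<sigma> using that \<open>\<And>\<sigma>. \<lbrakk>\<sigma> \<in> T; peval A (u \<sigma>) \<noteq> 0\<rbrakk> \<Longrightarrow> thesis\<close> by blast
    obtain q where q: "degree q \<le> d - m" "\<And>\<tau>. poly q \<tau> = peval A (u \<tau>)"
      using peval_on_affine_line[OF A, of "axis 1 1" "axis 2 1"] unfolding u_def by blast
    have "q = 0"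
    proof (rule ccontr)
      assume "q \<noteq> 0"
      then have "card T \<le> card {x. poly q x = 0}"
        using root q by (intro card_mono poly_roots_finite) auto
      also have "\<dots> \<le> degree q" by (rule card_poly_roots_bound[OF \<open>q \<noteq> 0\<close>])
      finally show False using T q(1) m \<open>m < d\<close> by linarith
    qed
    then have "peval A (axis 1 1 + \<tau> *s axis 2 1) = 0" for \<tau>
      using q(2)[of \<tau>] by (simp add: u_def)
    then have A0: "peval A (s *s axis 1 1 + t *s axis 2 1) = 0" for s t
      by (rule vanish_on_line[OF continuous_on_peval_UNIV peval_scale[OF A]])
    obtain x where x: "x $ 3 = 0" "x $ 4 = 0" "peval A x \<noteq> 0" using A_nz by blast
    have "x = x $ 1 *s axis 1 1 + x $ 2 *s axis 2 1"
      using x by (simp add: vec_eq_iff forall_4 axis_def)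
    then have "peval A x = peval A (x $ 1 *s axis 1 1 + x $ 2 *s axis 2 1)" by (rule arg_cong)
    then show False using x A0 by simp
  qed
  \<comment> \<open>On the line \<open>g\<close> is the derivative of \<open>G\<close> in the fourth
    direction. The leading constant is 1 because \<open>\<nu>\<close> takes the value 1 on the
    fourth basis vector.\<close>
  have g_line: "peval g (u \<tau>) = (\<Prod>\<rho>\<in>T. \<tau> - \<rho>)" for \<tau>
  proof -
    have "peval g (u \<tau>) = peval (partial_deriv 4 G) (u \<tau>)"
      using partial_deriv_decomposition[OF decG, of 4 "u \<tau>"] m by (simp add: u axis_def)
    also have "\<dots> = (\<Prod>\<rho>\<in>T. \<tau> - \<rho>) * (\<Sum>i\<in>UNIV. \<nu> $ i * B $ i $ 4)"
      unfolding G_def partial_deriv_linear_subst Bu gradient by (simp add: sum_distrib_left mult_ac)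
    finally show ?thesis unfolding Bcol by (simp add: axis_def)
  qed
  have "d \<ge> 1" using d by simp
  obtain \<gamma> v where \<gamma>: "\<gamma> 0 \<in> vec.span {a + \<sigma> *s b}" "\<gamma> 0 \<noteq> 0"
    "(\<gamma> has_vector_derivative v) (at 0)" "v \<notin> vec.span {\<gamma> 0}"
    "\<forall>i. \<exists>C. \<forall>\<^sub>F t::real in nhds 0. norm (peval (partial_deriv i F) (\<gamma> t)) \<le> C * \<bar>t\<bar> ^ (d - 1)"
    by (rule A_singularity_curve[OF homogeneous \<open>d \<ge> 1\<close> sing[OF \<sigma>(1)]]) (rule that)
  obtain \<kappa> where \<kappa>: "\<gamma> 0 = \<kappa> *s (a + \<sigma> *s b)"
    using \<gamma>(1) unfolding vec.span_singleton by auto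
  then have \<kappa>0: "\<kappa> \<noteq> 0" using \<gamma>(2) by auto
  define \<delta> where "\<delta> t = B' *v \<gamma> t" for t
  define w where "w = B' *v v"
  have BB': "B *v (B' *v x) = x" "B' *v (B *v x) = x" for x
    using B(1,2) by (simp_all add: matrix_vector_mul_assoc)
  have \<delta>0: "\<delta> 0 = \<kappa> *s u \<sigma>"
    unfolding \<delta>_def \<kappa> Bu[symmetric] matrix_vector_mult_scaleR vector_scalar_commute BB' by simp
  have d\<delta>: "(\<delta> has_vector_derivative w) (at 0)"
    unfolding \<delta>_def w_def
    by (rule bounded_linear.has_vector_derivative[OF matrix_vector_mul_bounded_linear \<gamma>(3)])
  have bound: "\<exists>C. \<forall>\<^sub>F t in nhds 0. norm (peval (partial_deriv k G) (\<delta> t)) \<le> C * \<bar>t\<bar> ^ (d - 1)" for k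
  proof -
    obtain C where C: "\<forall>i. \<forall>\<^sub>F t::real in nhds 0. norm (peval (partial_deriv i F) (\<gamma> t)) \<le> C i * \<bar>t\<bar> ^ (d - 1)"
      using choice[OF \<gamma>(5)] by (rule exE)
    have "\<forall>\<^sub>F t::real in nhds 0. \<forall>i. norm (peval (partial_deriv i F) (\<gamma> t)) \<le> C i * \<bar>t\<bar> ^ (d - 1)"
      by (rule eventually_all_finite) (rule C[THEN spec])
    then have "\<forall>\<^sub>F t in nhds 0. norm (peval (partial_deriv k G) (\<delta> t)) \<le> (\<Sum>i\<in>UNIV. norm (B $ i $ k) * C i) * \<bar>t\<bar> ^ (d - 1)"
    proof eventually_elim
      case (elim t)
      show ?case
        unfolding G_def partial_deriv_linear_subst \<delta>_def BB' sum_distrib_right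
        by (rule sum_norm_le) (use elim in \<open>auto simp: norm_mult mult.assoc intro!: mult_left_mono\<close>)
    qed
    then show ?thesis by blast
  qed
  have A\<delta>: "peval A (\<delta> 0) \<noteq> 0"
    unfolding \<delta>0 peval_scale[OF A] using \<kappa>0 \<sigma>(2) by simp
  have g\<delta>: "peval g (\<delta> 0) = 0"
    unfolding \<delta>0 peval_scale[OF g] g_line using \<sigma>(1) T(1) by auto
  have g2: "peval (partial_deriv 2 g) (\<delta> 0) \<noteq> 0"
  proof -
    obtain D where D: "D \<noteq> 0" "((\<lambda>\<tau>. \<Prod>\<rho>\<in>T. \<tau> - \<rho>) has_field_derivative D) (at \<sigma>)"
      by (rule DERIV_prod_roots[OF T(1) \<sigma>(1)])
    have "((\<lambda>s. peval g (u \<sigma> + s *s axis 2 1)) has_field_derivative peval (partial_deriv 2 g) (u \<sigma>)) (at 0)"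
      by (rule DERIV_peval_line)
    moreover have "u \<sigma> + s *s axis 2 1 = u (\<sigma> + s)" for s
      by (simp add: u_def vec_eq_iff algebra_simps)
    ultimately have "((\<lambda>s. \<Prod>\<rho>\<in>T. (\<sigma> + s) - \<rho>) has_field_derivative peval (partial_deriv 2 g) (u \<sigma>)) (at 0)"
      by (simp only: g_line)
    moreover have "((\<lambda>s. \<Prod>\<rho>\<in>T. (\<sigma> + s) - \<rho>) has_field_derivative D) (at 0)"
      using D(2) DERIV_shift[of "\<lambda>\<tau>. \<Prod>\<rho>\<in>T. \<tau> - \<rho>" D 0 \<sigma>] by (simp add: add.commute)
    ultimately have "peval (partial_deriv 2 g) (u \<sigma>) = D"
      by (rule DERIV_unique)
    then show ?thesis
      unfolding \<delta>0 peval_scale[OF homogeneous_partial_deriv[OF g]] using D(1) \<kappa>0 by simp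
  qed
  have w34: "w $ 3 = 0" "w $ 4 = 0" and gw: "(\<Sum>i\<in>UNIV. peval (partial_deriv i g) (\<delta> 0) * w $ i) = 0"
    using critical_curve_direction[OF decG m \<open>m < d\<close> d\<delta> _ _ A\<delta> g\<delta> g2 bound] by (simp_all add: \<delta>0 u)
  \<comment> \<open>By homogeneity the differential of \<open>g\<close> kills the radial direction
    \<open>u \<sigma>\<close>. It also kills \<open>w\<close>, and both vectors lie in the plane of
    the first two coordinates, where this differential is nonzero; so \<open>w\<close> is a multiple
    of \<open>u \<sigma>\<close>.\<close>
  have "(\<Sum>i\<in>UNIV. peval (partial_deriv i g) (\<delta> 0) * u \<sigma> $ i) = 0"
  proof (rule DERIV_direction_eq_0)
    fix s
    have "\<delta> 0 + s *s u \<sigma> = (\<kappa> + s) *s u \<sigma>" by (simp add: \<delta>0 vec_eq_iff algebra_simps)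
    moreover have "peval g (u \<sigma>) = 0" unfolding g_line using \<sigma>(1) T(1) by auto
    ultimately show "peval g (\<delta> 0 + s *s u \<sigma>) = 0" by (simp only: peval_scale[OF g]) simp
  qed
  then have g1: "peval (partial_deriv 1 g) (\<delta> 0) = - \<sigma> * peval (partial_deriv 2 g) (\<delta> 0)"
    by (simp add: sum_4 u eq_neg_iff_add_eq_0 mult.commute)
  have "peval (partial_deriv 2 g) (\<delta> 0) * (w $ 2 - \<sigma> * w $ 1) = 0"
    using gw w34 by (simp add: sum_4 g1 algebra_simps)
  then have "w $ 2 = \<sigma> * w $ 1" using g2 by simp
  then have "w = w $ 1 *s u \<sigma>"
    using w34 by (simp add: vec_eq_iff forall_4 u)
  then have "w = (w $ 1 / \<kappa>) *s \<delta> 0"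
    using \<kappa>0 by (simp add: \<delta>0)
  then have "B *v w = (w $ 1 / \<kappa>) *s (B *v \<delta> 0)"
    by (metis vector_scalar_commute)
  then have "v = (w $ 1 / \<kappa>) *s \<gamma> 0"
    by (simp add: w_def \<delta>_def BB')
  then show False
    using \<gamma>(4) vec.span_scale[OF vec.span_base[of "\<gamma> 0" "{\<gamma> 0}"]] by auto
qed

text \<open>\<open>m\<close> is the least exponent of the third variable among the monomials without
  the fourth. Such monomials exist since \<open>F\<close> does not vanish on the plane, and
  homogeneity gives \<open>m \<le> d\<close>, the bound opposite to
  \<open>no_intermediate_multiplicity\<close>.\<close>

lemma tangent_plane_section:
  obtains B B' :: "complex ^ 4 ^ 4" and e f c where
    "B ** B' = mat 1" "B' ** B = mat 1"
    "\<And>y. B *v y = y $ 1 *s a + y $ 2 *s b + y $ 3 *s e + y $ 4 *s f"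
    "\<And>y. (\<Sum>i\<in>UNIV. \<nu> $ i * (B *v y) $ i) = y $ 4"
    "c \<noteq> 0" "\<And>y. y $ 4 = 0 \<Longrightarrow> peval F (B *v y) = c * y $ 3 ^ d"
proof -
  obtain B B' :: "complex ^ 4 ^ 4" and e f where B: "B ** B' = mat 1" "B' ** B = mat 1"
    "\<And>y. B *v y = y $ 1 *s a + y $ 2 *s b + y $ 3 *s e + y $ 4 *s f"
    "\<And>y. (\<Sum>i\<in>UNIV. \<nu> $ i * (B *v y) $ i) = y $ 4"
    by (rule adapted_basis) (rule that)
  define G where "G = linear_subst B F"
  have hG: "homogeneous d G" unfolding G_def by (rule homogeneous_linear_subst[OF homogeneous])
  obtain j where j: "\<nu> $ j \<noteq> 0" by (rule \<nu>_nonzero)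
  obtain x0 where x0: "(\<Sum>i\<in>UNIV. \<nu> $ i * x0 $ i) = 0" "peval F x0 \<noteq> 0"
    by (rule irreducible_nonzero_on_hyperplane[OF homogeneous irreducible _ j]) (use d in auto)
  define y0 where "y0 = B' *v x0"
  have By0: "B *v y0 = x0" using B(1) by (simp add: y0_def matrix_vector_mul_assoc)
  then have y04: "y0 $ 4 = 0" using B(4)[of y0] x0(1) by simp
  have Gy0: "peval G y0 \<noteq> 0" using x0(2) By0 by (simp add: G_def)
  define K where "K = {k \<in> Poly_Mapping.keys G. Poly_Mapping.lookup k 4 = 0}"
  have "K \<noteq> {}"
  proof
    assume "K = {}"
    then have "Poly_Mapping.lookup k 4 \<noteq> 0" if "k \<in> Poly_Mapping.keys G" for k
      using that by (auto simp: K_def)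
    then have "peval G y0 = 0" by (rule peval_eq_0_if_keys[OF _ y04])
    then show False using Gy0 by simp
  qed
  define m where "m = Min ((\<lambda>k. Poly_Mapping.lookup k 3) ` K)"
  have finK: "finite K" by (simp add: K_def)
  then have "m \<in> (\<lambda>k. Poly_Mapping.lookup k 3) ` K"
    unfolding m_def using \<open>K \<noteq> {}\<close> by (intro Min_in) auto
  then obtain k0 where k0: "k0 \<in> K" "Poly_Mapping.lookup k0 3 = m" by auto
  have m_le: "m \<le> Poly_Mapping.lookup k 3" if "k \<in> Poly_Mapping.keys G" "Poly_Mapping.lookup k 4 = 0" for k
    unfolding m_def using finK that by (intro Min_le) (auto simp: K_def)
  obtain A g where Ag: "homogeneous (d - m) A" "homogeneous (d - 1) g"
    "\<And>x. peval G x = (x $ 3) ^ m * peval A x + x $ 4 * peval g x"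
    "\<exists>x. x $ 3 = 0 \<and> x $ 4 = 0 \<and> peval A x \<noteq> 0"
    by (rule decomposition_along_line[OF hG m_le, of k0]) (use k0 that in \<open>auto simp: K_def\<close>)
  have "m \<ge> d"
    by (rule no_intermediate_multiplicity[OF B Ag(1,2) Ag(3)[unfolded G_def] Ag(4)])
  moreover have "m \<le> d"
  proof -
    have "Poly_Mapping.lookup k0 3 \<le> (\<Sum>i\<in>UNIV. Poly_Mapping.lookup k0 i)"
      by (rule member_le_sum) auto
    then show ?thesis using hG k0 by (simp add: homogeneous_def K_def)
  qed
  ultimately have "m = d" by simp
  \<comment> \<open>For \<open>m = d\<close> the form \<open>A\<close> has degree 0, so it is the
    constant \<open>c\<close> of the claim.\<close>
  then have A0: "peval A x = peval A 0" for x
    using Ag(1) peval_homogeneous_0 by simp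
  have "peval A 0 \<noteq> 0" using Ag(4) A0 by metis
  moreover have "peval F (B *v y) = peval A 0 * y $ 3 ^ d" if "y $ 4 = 0" for y
    using Ag(3)[of y] that A0[of y] \<open>m = d\<close> by (simp add: G_def mult.commute)
  ultimately show thesis using that B by blast
qed

text \<open>The plane section is the line counted \<open>d\<close> times, which is a cone with
  vertex at every point of the line; what remains is to move the first coordinate vector to
  \<open>x\<close>.\<close>

lemma star_point_on_line:
  assumes x: "x = s *s a + t *s b" and ns: "vec.span {x} \<notin> sing_locus F" and "x \<noteq> 0"
  shows "star_point d F (vec.span {x})"
proof -
  obtain B B' :: "complex ^ 4 ^ 4" and e f c where B: "B ** B' = mat 1" "B' ** B = mat 1"
    "\<And>y. B *v y = y $ 1 *s a + y $ 2 *s b + y $ 3 *s e + y $ 4 *s f"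
    "\<And>y. (\<Sum>i\<in>UNIV. \<nu> $ i * (B *v y) $ i) = y $ 4"
    and c: "c \<noteq> 0" "\<And>y. y $ 4 = 0 \<Longrightarrow> peval F (B *v y) = c * y $ 3 ^ d"
    by (rule tangent_plane_section) (rule that)
  have scale: "peval (partial_deriv i F) (k *s y) = k ^ (d - 1) * peval (partial_deriv i F) y" for i k y
    by (rule peval_scale[OF homogeneous_partial_deriv[OF homogeneous]])
  have z: "vec.span {x} \<in> zero_locus F"
  proof -
    have "peval F (k *s x) = 0" for k
      using on_surface unfolding peval_scale[OF homogeneous] x by simp
    then show ?thesis
      using \<open>x \<noteq> 0\<close> by (auto simp: zero_locus_def proj_space_def vec.span_singleton)
  qed
  obtain j where j: "\<nu> $ j \<noteq> 0" by (rule \<nu>_nonzero)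
  \<comment> \<open>The gradient at \<open>x\<close> is \<open>\<mu>\<close> times
    \<open>\<nu>\<close>; smoothness of \<open>x\<close> makes the factor nonzero, so the tangent
    plane is the one defined by \<open>\<nu>\<close>.\<close>
  define \<mu> where "\<mu> = peval (partial_deriv j F) x / \<nu> $ j"
  have grad: "peval (partial_deriv i F) x = \<mu> * \<nu> $ i" for i
    using gradient_proportional[of i s t j] j by (simp add: \<mu>_def x field_simps)
  have "\<mu> \<noteq> 0"
  proof
    assume "\<mu> = 0"
    then have "peval (partial_deriv i F) (k *s x) = 0" for i k
      by (simp add: scale grad)
    then have "vec.span {x} \<in> sing_locus F"
      using z by (auto simp: sing_locus_def vec.span_singleton)
    then show False using ns by simp
  qed
  have tangent: "tangent_space F (vec.span {x}) = {y. (\<Sum>i\<in>UNIV. \<nu> $ i * y $ i) = 0}"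
  proof -
    have eq: "(\<Sum>i\<in>UNIV. peval (partial_deriv i F) (k *s x) * y $ i) = k ^ (d - 1) * \<mu> * (\<Sum>i\<in>UNIV. \<nu> $ i * y $ i)" for k y
      by (simp add: scale grad sum_distrib_left mult_ac)
    have "(\<forall>k. k ^ (d - 1) * \<mu> * (\<Sum>i\<in>UNIV. \<nu> $ i * y $ i) = 0) \<longleftrightarrow> (\<Sum>i\<in>UNIV. \<nu> $ i * y $ i) = 0" for y
      using \<open>\<mu> \<noteq> 0\<close> by (auto dest: spec[of _ 1])
    then show ?thesis
      unfolding tangent_space_def vec.span_singleton by (simp add: eq)
  qed
  \<comment> \<open>A second point spanning the line together with \<open>x\<close>: it is
    \<open>a\<close> if \<open>x\<close> is a multiple of \<open>b\<close>, and \<open>b\<close>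
    otherwise.\<close>
  obtain s' t' where st': "s * t' - t * s' \<noteq> 0"
  proof (cases "s = 0")
    case True
    then have "t \<noteq> 0" using \<open>x \<noteq> 0\<close> x by auto
    then show ?thesis using that[of 0 1] True by simp
  next
    case False
    then show ?thesis using that[of 1 0] by simp
  qed
  define D where "D = s * t' - t * s'"
  have D: "D \<noteq> 0" using st' by (simp add: D_def)
  text \<open>The columns of \<open>N\<close> are the coordinates of \<open>x\<close>, of a second point of the line and of \<open>e\<close> with
    respect to the adapted basis.\<close>
  define N :: "complex ^ 3 ^ 4" where
    "N = (\<chi> i k. if i = 1 then (if k = 1 then s else if k = 2 then s' else 0)
              else if i = 2 then (if k = 1 then t else if k = 2 then t' else 0)
              else if i = 3 then (if k = 3 then 1 else 0) else 0)"
  have N: "(N *v Y) $ 1 = s * Y $ 1 + s' * Y $ 2" "(N *v Y) $ 2 = t * Y $ 1 + t' * Y $ 2"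
    "(N *v Y) $ 3 = Y $ 3" "(N *v Y) $ 4 = 0" for Y
    by (simp_all add: N_def matrix_vector_mult_def sum_3)
  define M where "M = B ** N"
  have M: "M *v Y = B *v (N *v Y)" for Y
    by (simp add: M_def matrix_vector_mul_assoc)
  have BB': "B *v (B' *v y) = y" "B' *v (B *v y) = y" for y
    using B(1,2) by (simp_all add: matrix_vector_mul_assoc)
  have inj: "inj ((*v) M)"
  proof (rule injI)
    fix Y Z assume "M *v Y = M *v Z"
    then have eq: "N *v Y = N *v Z" unfolding M by (metis BB'(2))
    \<comment> \<open>Cramer's rule for the first two coordinates, with determinant
      \<open>D\<close>; the same formulas give the preimage \<open>Y\<close> in the proof of
      surjectivity.\<close>
    have "D * Y $ 1 = t' * (N *v Y) $ 1 - s' * (N *v Y) $ 2" for Y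
      by (simp add: N D_def algebra_simps)
    then have "D * Y $ 1 = D * Z $ 1" using eq by metis
    moreover have "D * Y $ 2 = s * (N *v Y) $ 2 - t * (N *v Y) $ 1" for Y
      by (simp add: N D_def algebra_simps)
    then have "D * Y $ 2 = D * Z $ 2" using eq by metis
    moreover have "Y $ 3 = Z $ 3" using N(3)[of Y] N(3)[of Z] eq by simp
    ultimately show "Y = Z" using D by (simp add: vec_eq_iff forall_3)
  qed
  have range: "range ((*v) M) = tangent_space F (vec.span {x})"
    unfolding tangent
  proof (intro equalityI subsetI)
    fix y assume "y \<in> range ((*v) M)"
    then show "y \<in> {y. (\<Sum>i\<in>UNIV. \<nu> $ i * y $ i) = 0}"
      by (auto simp: M B(4) N)
  next
    fix y assume "y \<in> {y. (\<Sum>i\<in>UNIV. \<nu> $ i * y $ i) = 0}"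
    then have z4: "(B' *v y) $ 4 = 0" using B(4)[of "B' *v y"] BB'(1) by simp
    define z where "z = B' *v y"
    define Y :: "complex ^ 3" where
      "Y = (\<chi> k. if k = 1 then (t' * z $ 1 - s' * z $ 2) / D else if k = 2 then (s * z $ 2 - t * z $ 1) / D else z $ 3)"
    have Y: "D * Y $ 1 = t' * z $ 1 - s' * z $ 2" "D * Y $ 2 = s * z $ 2 - t * z $ 1" "Y $ 3 = z $ 3"
      using D by (simp_all add: Y_def)
    have "D * (s * Y $ 1 + s' * Y $ 2) = s * (D * Y $ 1) + s' * (D * Y $ 2)" by (simp add: algebra_simps)
    also have "\<dots> = D * z $ 1" unfolding Y by (simp add: D_def algebra_simps)
    finally have 1: "s * Y $ 1 + s' * Y $ 2 = z $ 1" using D by simp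
    have "D * (t * Y $ 1 + t' * Y $ 2) = t * (D * Y $ 1) + t' * (D * Y $ 2)" by (simp add: algebra_simps)
    also have "\<dots> = D * z $ 2" unfolding Y by (simp add: D_def algebra_simps)
    finally have 2: "t * Y $ 1 + t' * Y $ 2 = z $ 2" using D by simp
    have "N *v Y = z"
      using 1 2 Y(3) z4 by (simp add: vec_eq_iff forall_4 N z_def)
    then have "M *v Y = y" by (simp add: M z_def BB')
    then show "y \<in> range ((*v) M)" by blast
  qed
  have Mx: "M *v axis 1 1 = x"
    unfolding M B(3) N by (simp add: x axis_def)
  \<comment> \<open>The third coordinate on the tangent plane cuts out the line, so only its
    \<open>d\<close>-th power survives and the coordinate belonging to \<open>x\<close> does not
    occur.\<close>
  have subst: "linear_subst M F = Poly_Mapping.single (Poly_Mapping.single 3 d) c"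
  proof (rule peval_inject)
    fix Y
    have "peval F (M *v Y) = c * Y $ 3 ^ d"
      unfolding M using c(2)[of "N *v Y"] by (simp add: N)
    then show "peval (linear_subst M F) Y = peval (Poly_Mapping.single (Poly_Mapping.single 3 d) c) Y"
      by simp
  qed
  show ?thesis
    unfolding star_point_def
  proof (intro conjI exI[of _ M])
    show "linear_subst M F \<noteq> 0"
      unfolding subst using c(1) by (simp flip: keys_eq_empty)
    show "homogeneous d (linear_subst M F)"
      unfolding subst by (rule homogeneous_single) simp
    show "\<forall>m\<in>Poly_Mapping.keys (linear_subst M F). Poly_Mapping.lookup m 1 = 0"
      unfolding subst by (auto simp: lookup_single split: if_splits)
  qed (use z ns inj range Mx in auto)
qed

end

section \<open>From the smooth points of the line to its general point\<close>

theorem proposition4p1: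
  fixes F :: "4 cpoly" and d :: nat and \<Lambda> :: "(complex ^ 4) set set"
  assumes "d \<ge> 3"
    and "irreducible_surface d F"
    and "proj_line \<Lambda>"
    and "\<Lambda> \<subseteq> zero_locus F"
    and "\<not> \<Lambda> \<subseteq> sing_locus F"
    and "\<exists>S. S \<subseteq> \<Lambda> \<and> finite S \<and> card S = d - 1 \<and> (\<forall>p\<in>S. A_singularity (d - 1) F p)"
  shows "general_point \<Lambda> (star_point d F)"
proof -
  obtain S where S: "S \<subseteq> \<Lambda>" "finite S" "card S = d - 1" "\<And>p. p \<in> S \<Longrightarrow> A_singularity (d - 1) F p"
    using assms(6) by blast
  obtain a b where ab: "\<And>s t. s *s a + t *s b = 0 \<Longrightarrow> s = 0 \<and> t = 0"
    and \<Lambda>: "\<Lambda> = {p \<in> proj_space. p \<subseteq> vec.span {a, b}}"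
    and S_points: "\<And>p. p \<in> S \<Longrightarrow> \<exists>\<tau>. p = vec.span {a + \<tau> *s b}"
    by (rule proj_line_coordinates[OF assms(3) S(2,1)]) (rule that)
  have F: "homogeneous d F" "irreducible F"
    using assms(2) by (auto simp: irreducible_surface_def)
  define T where "T = {\<tau>. vec.span {a + \<tau> *s b} \<in> S}"
  have "bij_betw (\<lambda>\<tau>. vec.span {a + \<tau> *s b}) T S"
    unfolding bij_betw_def
  proof
    show "inj_on (\<lambda>\<tau>. vec.span {a + \<tau> *s b}) T"
      by (rule inj_onI) (rule line_point_inject[OF ab])
    show "(\<lambda>\<tau>. vec.span {a + \<tau> *s b}) ` T = S"
      using S_points by (auto simp: T_def)
  qed
  then have T: "finite T" "card T = d - 1"
    using S(2,3) bij_betw_finite bij_betw_same_card by metis+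
  have pt: "vec.span {s *s a + t *s b} \<in> \<Lambda>" if "s *s a + t *s b \<noteq> 0" for s t
  proof -
    have "s *s a + t *s b \<in> vec.span {a, b}" using span_pair by blast
    then have "vec.span {s *s a + t *s b} \<subseteq> vec.span {a, b}"
      by (intro vec.span_minimal) auto
    then show ?thesis using that by (auto simp: \<Lambda> proj_space_def)
  qed
  have \<Lambda>_points: "\<exists>s t x. x = s *s a + t *s b \<and> x \<noteq> 0 \<and> p = vec.span {x}" if "p \<in> \<Lambda>" for p
  proof -
    obtain x where "p = vec.span {x}" "x \<noteq> 0" "p \<subseteq> vec.span {a, b}"
      using \<open>p \<in> \<Lambda>\<close> by (auto simp: \<Lambda> proj_space_def)
    moreover have "x \<in> vec.span {a, b}"
      using calculation vec.span_base[of x "{x}"] by auto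
    ultimately show ?thesis unfolding span_pair by blast
  qed
  interpret surface_line F d a b T
  proof
    show "peval F (s *s a + t *s b) = 0" for s t
    \<comment> \<open>The zero vector represents no point of \<Lambda>, so there the value comes
      from homogeneity in positive degree.\<close>
    proof (cases "s *s a + t *s b = 0")
      case True
      then show ?thesis using peval_scale[OF F(1), of 0 0] assms(1) by (simp add: power_0_left)
    next
      case False
      then show ?thesis
        using pt[OF False] assms(4) vec.span_base[of "s *s a + t *s b" "{s *s a + t *s b}"]
        by (auto simp: zero_locus_def)
    qed
    show "\<exists>s t i. peval (partial_deriv i F) (s *s a + t *s b) \<noteq> 0"
    proof -
      obtain p where p: "p \<in> \<Lambda>" "p \<notin> sing_locus F" using assms(5) by blast
      then obtain i x where "x \<in> p" "peval (partial_deriv i F) x \<noteq> 0"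
        using assms(4) by (auto simp: sing_locus_def)
      moreover have "x \<in> vec.span {a, b}" using p(1) \<open>x \<in> p\<close> by (auto simp: \<Lambda>)
      ultimately show ?thesis unfolding span_pair by blast
    qed
  qed (use F assms(1) ab T S(4) in \<open>auto simp: T_def\<close>)
  show ?thesis
    unfolding general_point_def zariski_open_in_def
  proof (intro exI conjI ballI)
    \<comment> \<open>The open set is the full smooth part of the line: every smooth point of the
      surface on \<Lambda> is a star point.\<close>
    show "zariski_closed (sing_locus F)" by (rule zariski_closed_sing_locus[OF F(1)])
    show "\<Lambda> - sing_locus F \<noteq> {}" using assms(5) by blast
    fix p assume p: "p \<in> \<Lambda> - sing_locus F"
    then obtain s t x where "x = s *s a + t *s b" "x \<noteq> 0" "p = vec.span {x}"
      using \<Lambda>_points by blast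
    then show "star_point d F p" using star_point_on_line p by simp
  qed (rule refl)
qed

end
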